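(* Let $k$ be a field and $f:R\to S$ a homomorphism of commutative $k$-algebras which maps an ideal $I$ of $R$ isomorphically onto an ideal of $S$ (also denoted $I$). Let $HH_0(R,S,I)$ denote the cokernel of the induced map $HH_1(R,I)\to HH_1(S,I)$. Then the map $S\otimes I+I\otimes S\to I\otimes_S\Omega_{S/R}$ given by $x\otimes r\mapsto x\otimes dr$ and $r\otimes x\mapsto -x\otimes dr$ ($x\in I$, $r\in S$) induces isomorphisms of $R$-modules $$HH_0(R,S,I)\cong I\otimes_S\Omega_{S/R}\cong(I/I^2)\otimes_{S/I}\Omega_{(S/I)/(R/I)}.$$
   Context: Tensor products without subscript are over $k$. For a commutative $k$-algebra $T$ and ideal $I$, $HH_1(T,I)$ is the quotient of $T\otimes I+I\otimes T\subseteq T\otimes T$ by the image of $T\otimes T\otimes I+T\otimes I\otimes T+I\otimes T\otimes T$ under $b(x\otimes y\otimes z)=xy\otimes z-x\otimes yz+zx\otimes y$; $f$ induces $HH_1(R,I)\to HH_1(S,I)$. $\Omega_{S/R}$ is the module of Kähler differentials of $S$ relative to $R$. *)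

theory Defs
  imports "HOL-Algebra.Algebra" "HOL-Library.Function_Algebras"
begin

text \<open>The field k, viewed as a HOL-Algebra ring, so that k-algebra structures
  are ring homomorphisms from it.\<close>
definition kring :: "('k::field) ring" where
  "kring = \<lparr>carrier = UNIV, monoid.mult = (*), one = 1, ring.zero = 0, ring.add = (+)\<rparr>"

text \<open>Basis vector of the free k-vector space on a set of symbols.\<close>
definition dlt :: "'x \<Rightarrow> ('x \<Rightarrow> 'k::field)" where
  "dlt a = (\<lambda>x. if x = a then 1 else 0)"

definition ksc :: "'k::field \<Rightarrow> ('x \<Rightarrow> 'k) \<Rightarrow> ('x \<Rightarrow> 'k)" where
  "ksc c v = (\<lambda>x. c * v x)"

definition kspan :: "('x \<Rightarrow> 'k::field) set \<Rightarrow> ('x \<Rightarrow> 'k) set" where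
  "kspan G = {v. \<exists>A c. finite A \<and> A \<subseteq> G \<and> v = (\<lambda>x. \<Sum>g\<in>A. c g * g x)}"

text \<open>Linear extension of a map given on basis symbols (applied to finitely supported vectors).\<close>
definition lin_ext :: "('x \<Rightarrow> ('y \<Rightarrow> 'k::field)) \<Rightarrow> ('x \<Rightarrow> 'k) \<Rightarrow> ('y \<Rightarrow> 'k)" where
  "lin_ext h v = (\<lambda>y. \<Sum>x\<in>{x. v x \<noteq> 0}. v x * h x y)"

definition cls :: "('x \<Rightarrow> 'k::field) set \<Rightarrow> ('x \<Rightarrow> 'k) \<Rightarrow> ('x \<Rightarrow> 'k) set" where
  "cls N v = {(\<lambda>x. v x + w x) | w. w \<in> N}"

definition rp :: "'a set \<Rightarrow> 'a" where
  "rp Y = (SOME v. v \<in> Y)"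

text \<open>A linear map phi on the ambient free spaces induces a (well-defined) isomorphism
  A1/B1 \<rightarrow> A2/B2 (B1 \<subseteq> A1, B2 \<subseteq> A2 subspaces).\<close>
definition induces_iso ::
  "(('x \<Rightarrow> 'k::field) \<Rightarrow> ('y \<Rightarrow> 'k)) \<Rightarrow> ('x \<Rightarrow> 'k) set \<Rightarrow> ('x \<Rightarrow> 'k) set
    \<Rightarrow> ('y \<Rightarrow> 'k) set \<Rightarrow> ('y \<Rightarrow> 'k) set \<Rightarrow> bool" where
  "induces_iso \<phi> A1 B1 A2 B2 \<longleftrightarrow>
     \<phi> ` A1 \<subseteq> A2 \<and> \<phi> ` B1 \<subseteq> B2 \<and>
     (\<forall>v\<in>A1. \<phi> v \<in> B2 \<longrightarrow> v \<in> B1) \<and>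
     (\<forall>w\<in>A2. \<exists>v\<in>A1. (\<lambda>y. w y - \<phi> v y) \<in> B2)"

text \<open>The induced map is compatible with given actions of a ring (carrier Rc)
  on the two quotients (actions given on the ambient spaces).\<close>
definition compat_act ::
  "'a set \<Rightarrow> ('a \<Rightarrow> ('x \<Rightarrow> 'k::field) \<Rightarrow> ('x \<Rightarrow> 'k)) \<Rightarrow> ('a \<Rightarrow> ('y \<Rightarrow> 'k) \<Rightarrow> ('y \<Rightarrow> 'k))
    \<Rightarrow> (('x \<Rightarrow> 'k) \<Rightarrow> ('y \<Rightarrow> 'k)) \<Rightarrow> ('x \<Rightarrow> 'k) set \<Rightarrow> ('y \<Rightarrow> 'k) set \<Rightarrow> bool" where
  "compat_act Rc act1 act2 \<phi> A1 B2 \<longleftrightarrow>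
     (\<forall>r\<in>Rc. \<forall>v\<in>A1. (\<lambda>y. \<phi> (act1 r v) y - act2 r (\<phi> v) y) \<in> B2)"

text \<open>T \<otimes> T = free k-space on carrier T \<times> carrier T modulo the span of these bilinearity relations;
  the k-structure of T is given by \<iota> (scalar c acts as \<iota> c \<otimes> _).\<close>
definition ktens_rel :: "('t, 'm) ring_scheme \<Rightarrow> ('k::field \<Rightarrow> 't) \<Rightarrow> ('t \<times> 't \<Rightarrow> 'k) set" where
  "ktens_rel T \<iota> =
     {dlt (a \<oplus>\<^bsub>T\<^esub> a', b) - dlt (a, b) - dlt (a', b) | a a' b.
        a \<in> carrier T \<and> a' \<in> carrier T \<and> b \<in> carrier T}
   \<union> {dlt (a, b \<oplus>\<^bsub>T\<^esub> b') - dlt (a, b) - dlt (a, b') | a b b'.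
        a \<in> carrier T \<and> b \<in> carrier T \<and> b' \<in> carrier T}
   \<union> {dlt (\<iota> c \<otimes>\<^bsub>T\<^esub> a, b) - ksc c (dlt (a, b)) | c a b. a \<in> carrier T \<and> b \<in> carrier T}
   \<union> {dlt (a, \<iota> c \<otimes>\<^bsub>T\<^esub> b) - ksc c (dlt (a, b)) | c a b. a \<in> carrier T \<and> b \<in> carrier T}"

definition hb :: "('t, 'm) ring_scheme \<Rightarrow> 't \<Rightarrow> 't \<Rightarrow> 't \<Rightarrow> ('t \<times> 't \<Rightarrow> 'k::field)" where
  "hb T x y z = dlt (x \<otimes>\<^bsub>T\<^esub> y, z) - dlt (x, y \<otimes>\<^bsub>T\<^esub> z) + dlt (z \<otimes>\<^bsub>T\<^esub> x, y)"

text \<open>The subspace T \<otimes> I + I \<otimes> T \<subseteq> T \<otimes> T: it is Z/(Z \<inter> Bil), where Z is the span of the basis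
  symbols (x,y) with x \<in> I or y \<in> I and Bil is the span of the bilinearity relations.\<close>
definition hh_cyc :: "('t, 'm) ring_scheme \<Rightarrow> 't set \<Rightarrow> ('t \<times> 't \<Rightarrow> 'k::field) set" where
  "hh_cyc T I = kspan {dlt (x, y) | x y. x \<in> carrier T \<and> y \<in> carrier T \<and> (x \<in> I \<or> y \<in> I)}"

text \<open>Relations to divide Z by to get HH_1(T,I): the kernel Z \<inter> Bil of Z \<rightarrow> T \<otimes> T, and the
  (preimage in Z of) the image b(T\<otimes>T\<otimes>I + T\<otimes>I\<otimes>T + I\<otimes>T\<otimes>T).\<close>
definition hh_bd :: "('t, 'm) ring_scheme \<Rightarrow> ('k::field \<Rightarrow> 't) \<Rightarrow> 't set \<Rightarrow> ('t \<times> 't \<Rightarrow> 'k) set" where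
  "hh_bd T \<iota> I = kspan ({hb T x y z | x y z. x \<in> carrier T \<and> y \<in> carrier T \<and> z \<in> carrier T
                                             \<and> (x \<in> I \<or> y \<in> I \<or> z \<in> I)}
                        \<union> (hh_cyc T I \<inter> kspan (ktens_rel T \<iota>)))"

text \<open>HH_1(T,I) = hh_cyc T I / hh_bd T \<iota> I.  The map f \<otimes> f on the free spaces:\<close>
definition tens_map :: "('r \<Rightarrow> 's) \<Rightarrow> ('r \<times> 'r \<Rightarrow> 'k::field) \<Rightarrow> ('s \<times> 's \<Rightarrow> 'k)" where
  "tens_map f = lin_ext (\<lambda>(a, b). dlt (f a, f b))"

text \<open>HH_0(R,S,I) = coker(HH_1(R,I) \<rightarrow> HH_1(S,I)) = hh0_top / hh0_bot.\<close>
definition hh0_top where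
  "hh0_top S J = hh_cyc S J"

definition hh0_bot where
  "hh0_bot R \<iota>R S \<iota>S f I J = kspan (hh_bd S \<iota>S J \<union> tens_map f ` hh_cyc R I)"

text \<open>The free B-module on symbols dc (c \<in> B), realised as free k-space on pairs (b,c) = b dc
  modulo linearity in b, and the B-submodule generated by the derivation relations
  d(c+c') = dc + dc', d(cc') = c dc' + c' dc, d(g a) = 0.\<close>
definition kahler_rel ::
  "('b, 'm) ring_scheme \<Rightarrow> ('k::field \<Rightarrow> 'b) \<Rightarrow> ('a, 'n) ring_scheme \<Rightarrow> ('a \<Rightarrow> 'b) \<Rightarrow> ('b \<times> 'b \<Rightarrow> 'k) set" where
  "kahler_rel B \<iota> A g = kspan (
     {dlt (b \<oplus>\<^bsub>B\<^esub> b', c) - dlt (b, c) - dlt (b', c) | b b' c.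
        b \<in> carrier B \<and> b' \<in> carrier B \<and> c \<in> carrier B}
   \<union> {dlt (\<iota> e \<otimes>\<^bsub>B\<^esub> b, c) - ksc e (dlt (b, c)) | e b c. b \<in> carrier B \<and> c \<in> carrier B}
   \<union> {dlt (b, c \<oplus>\<^bsub>B\<^esub> c') - dlt (b, c) - dlt (b, c') | b c c'.
        b \<in> carrier B \<and> c \<in> carrier B \<and> c' \<in> carrier B}
   \<union> {dlt (b, c \<otimes>\<^bsub>B\<^esub> c') - dlt (b \<otimes>\<^bsub>B\<^esub> c, c') - dlt (b \<otimes>\<^bsub>B\<^esub> c', c) | b c c'.
        b \<in> carrier B \<and> c \<in> carrier B \<and> c' \<in> carrier B}
   \<union> {dlt (b, g a) | b a. b \<in> carrier B \<and> a \<in> carrier A})"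

definition kahler :: "('b, 'm) ring_scheme \<Rightarrow> ('k::field \<Rightarrow> 'b) \<Rightarrow> ('a, 'n) ring_scheme \<Rightarrow> ('a \<Rightarrow> 'b)
    \<Rightarrow> ('b \<times> 'b \<Rightarrow> 'k) set set" where
  "kahler B \<iota> A g = {cls (kahler_rel B \<iota> A g) v | v.
      v \<in> kspan {dlt (b, c) | b c. b \<in> carrier B \<and> c \<in> carrier B}}"

definition kahler_add where
  "kahler_add B \<iota> A g \<omega> \<omega>' = cls (kahler_rel B \<iota> A g) (rp \<omega> + rp \<omega>')"

definition kahler_act where
  "kahler_act B \<iota> A g s \<omega> =
     cls (kahler_rel B \<iota> A g) (lin_ext (\<lambda>(b, c). dlt (s \<otimes>\<^bsub>B\<^esub> b, c)) (rp \<omega>))"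

definition kd where
  "kd B \<iota> A g c = cls (kahler_rel B \<iota> A g) (dlt (\<one>\<^bsub>B\<^esub>, c))"

text \<open>Modules given by carrier, addition and B-action; the result is
  tens_top / tens_rel (free k-space on M \<times> N modulo balanced bilinearity).\<close>
definition tens_top :: "'m set \<Rightarrow> 'n set \<Rightarrow> ('m \<times> 'n \<Rightarrow> 'k::field) set" where
  "tens_top Mc Nc = kspan {dlt (m, n) | m n. m \<in> Mc \<and> n \<in> Nc}"

definition tens_rel ::
  "('b, 'z) ring_scheme \<Rightarrow> ('k::field \<Rightarrow> 'b) \<Rightarrow> 'm set \<Rightarrow> ('m \<Rightarrow> 'm \<Rightarrow> 'm) \<Rightarrow> ('b \<Rightarrow> 'm \<Rightarrow> 'm)
    \<Rightarrow> 'n set \<Rightarrow> ('n \<Rightarrow> 'n \<Rightarrow> 'n) \<Rightarrow> ('b \<Rightarrow> 'n \<Rightarrow> 'n) \<Rightarrow> ('m \<times> 'n \<Rightarrow> 'k) set" where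
  "tens_rel B \<iota> Mc addM actM Nc addN actN = kspan (
     {dlt (addM m m', n) - dlt (m, n) - dlt (m', n) | m m' n. m \<in> Mc \<and> m' \<in> Mc \<and> n \<in> Nc}
   \<union> {dlt (m, addN n n') - dlt (m, n) - dlt (m, n') | m n n'. m \<in> Mc \<and> n \<in> Nc \<and> n' \<in> Nc}
   \<union> {dlt (actM b m, n) - dlt (m, actN b n) | b m n. b \<in> carrier B \<and> m \<in> Mc \<and> n \<in> Nc}
   \<union> {dlt (actM (\<iota> e) m, n) - ksc e (dlt (m, n)) | e m n. m \<in> Mc \<and> n \<in> Nc})"

text \<open>I \<otimes>_S \<Omega>_{S/R}, with J = f(I) the ideal of S.\<close>
definition IOm_top where
  "IOm_top S \<iota>S R f J = tens_top J (kahler S \<iota>S R f)"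

definition IOm_rel where
  "IOm_rel S \<iota>S R f J = tens_rel S \<iota>S J (\<lambda>x y. x \<oplus>\<^bsub>S\<^esub> y) (\<lambda>s x. s \<otimes>\<^bsub>S\<^esub> x)
      (kahler S \<iota>S R f) (kahler_add S \<iota>S R f) (kahler_act S \<iota>S R f)"

definition phi1 where
  "phi1 S \<iota>S R f J = lin_ext (\<lambda>(a, b).
      if a \<in> J then dlt (a, kd S \<iota>S R f b)
      else if b \<in> J then - dlt (b, kd S \<iota>S R f a) else 0)"

definition qmap where
  "qmap S f J \<xi> = J +>\<^bsub>S\<^esub> f (rp \<xi>)"

definition qiota where
  "qiota S \<iota>S J e = J +>\<^bsub>S\<^esub> \<iota>S e"

definition II2 where
  "II2 S J = {(ideal_prod S J J) +>\<^bsub>S\<^esub> x | x. x \<in> J}"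

definition II2_act where
  "II2_act S J c \<xi> = (ideal_prod S J J) +>\<^bsub>S\<^esub> (rp c \<otimes>\<^bsub>S\<^esub> rp \<xi>)"

abbreviation Omq where
  "Omq S \<iota>S R f I J \<equiv> kahler (S Quot J) (qiota S \<iota>S J) (R Quot I) (qmap S f J)"

definition QT_top where
  "QT_top S \<iota>S R f I J = tens_top (II2 S J) (Omq S \<iota>S R f I J)"

definition QT_rel where
  "QT_rel S \<iota>S R f I J = tens_rel (S Quot J) (qiota S \<iota>S J) (II2 S J) (set_add S) (II2_act S J)
      (Omq S \<iota>S R f I J)
      (kahler_add (S Quot J) (qiota S \<iota>S J) (R Quot I) (qmap S f J))
      (kahler_act (S Quot J) (qiota S \<iota>S J) (R Quot I) (qmap S f J))"

definition om_map where
  "om_map S \<iota>S R f I J \<omega> =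
     cls (kahler_rel (S Quot J) (qiota S \<iota>S J) (R Quot I) (qmap S f J))
         (lin_ext (\<lambda>(b, c). dlt (J +>\<^bsub>S\<^esub> b, J +>\<^bsub>S\<^esub> c)) (rp \<omega>))"

definition phi2 where
  "phi2 S \<iota>S R f I J = lin_ext (\<lambda>(x, \<omega>).
      dlt ((ideal_prod S J J) +>\<^bsub>S\<^esub> x, om_map S \<iota>S R f I J \<omega>))"

definition act_hh where
  "act_hh S f r = lin_ext (\<lambda>(a, b). dlt (f r \<otimes>\<^bsub>S\<^esub> a, b))"

definition act_IOm where
  "act_IOm S f r = lin_ext (\<lambda>(x, \<omega>). dlt (f r \<otimes>\<^bsub>S\<^esub> x, \<omega>))"

definition act_QT where
  "act_QT S f J r = lin_ext (\<lambda>(\<xi>, \<eta>). dlt ((ideal_prod S J J) +>\<^bsub>S\<^esub> (f r \<otimes>\<^bsub>S\<^esub> rp \<xi>), \<eta>))"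

end

theory Submission
  imports Defs
begin

text \<open>Since \<open>J = f(I)\<close> lies in the image of \<open>R\<close>, one has \<open>dj = 0\<close> and
  \<open>j dc = d(jc) - c dj = 0\<close> in \<open>\<Omega>\<^bsub>S/R\<^esub>\<close> for \<open>j \<in> J\<close>: the ideal kills the differentials.
  Hence \<open>\<Omega>\<^bsub>S/R\<^esub>\<close> is already the module of differentials of \<open>S/J\<close> over \<open>R/I\<close> and \<open>J\<^sup>2 \<otimes> \<Omega>\<close>
  vanishes, which gives the second isomorphism. For the first one, the inverse sends
  \<open>x \<otimes> b dc\<close> to \<open>xb \<otimes> c\<close>; for this one needs
  \<open>r \<otimes> x = - x \<otimes> r\<close> in \<open>HH\<^sub>0(R, S, I)\<close>, which holds because \<open>b(1 \<otimes> r \<otimes> x) = r \<otimes> x - 1 \<otimes> rx + x \<otimes> r\<close>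
  and \<open>1 \<otimes> rx\<close> comes from \<open>R\<close>.\<close>

section \<open>Finitely supported vectors\<close>

text \<open>The obstacle is well-definedness. Every quotient is encoded by two subspaces of a
  function space, and a symbol \<open>(x, \<omega>)\<close> of a tensor product has a class, that is
  a set, as its second entry. Maps may be prescribed freely on symbols; the work lies in showing
  that relations go to relations. The inverse maps choose representatives with \<open>rp\<close>,
  which is not additive, so they invert only modulo the relations. The inverse of the first map is
  well defined because every relation of \<Omega>, multiplied by \<open>x\<close> in
  \<open>J\<close>, becomes a relation of the cokernel: the Leibniz rule for \<open>b d(cc')\<close>
  becomes the boundary of \<open>xb \<otimes> c \<otimes> c'\<close>, and \<open>b d(f a)\<close>
  becomes \<open>xb \<otimes> f a\<close>, which comes from \<open>R\<close> because
  \<open>xb\<close> lies in \<open>f(I)\<close>. In the other direction the difficulty is that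
  \<open>S \<otimes> I + I \<otimes> S\<close> is a subspace of \<open>S \<otimes> S\<close>: linear
  relations between its elements may use symbols outside it. Complements of subspaces over a field
  resolve this.\<close>

interpretation kv: vector_space "ksc :: 'k::field \<Rightarrow> ('x \<Rightarrow> 'k) \<Rightarrow> ('x \<Rightarrow> 'k)"
  by unfold_locales (auto simp: ksc_def fun_eq_iff algebra_simps)

lemma sum_apply: "(\<Sum>a\<in>A. F a) x = (\<Sum>a\<in>A. F a x :: 'k::field)"
  by (induction A rule: infinite_finite_induct) (auto simp: zero_fun_def)

lemma kspan_eq_span: "kspan G = kv.span G"
  unfolding kspan_def kv.span_explicit by (auto simp: ksc_def fun_eq_iff sum_apply)

lemma subspace_kspan [simp]: "kv.subspace (kspan G)"
  by (simp add: kspan_eq_span)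

lemma kspan_base: "v \<in> G \<Longrightarrow> v \<in> kspan G"
  by (simp add: kspan_eq_span kv.span_base)

lemma kspan_subset: "G \<subseteq> B \<Longrightarrow> kv.subspace B \<Longrightarrow> kspan G \<subseteq> B"
  by (simp add: kspan_eq_span kv.span_minimal)

definition fin_supp :: "('x \<Rightarrow> 'k::field) set" where
  "fin_supp = {v. finite {x. v x \<noteq> 0}}"

lemma subspace_fin_supp [simp]: "kv.subspace (fin_supp :: ('x \<Rightarrow> 'k::field) set)"
proof (rule kv.subspaceI)
  show "0 \<in> fin_supp" by (simp add: fin_supp_def zero_fun_def)
next
  fix v w :: "'x \<Rightarrow> 'k" assume "v \<in> fin_supp" "w \<in> fin_supp"
  then have "finite ({x. v x \<noteq> 0} \<union> {x. w x \<noteq> 0})" by (simp add: fin_supp_def)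
  then show "v + w \<in> fin_supp" unfolding fin_supp_def mem_Collect_eq
    by (rule rev_finite_subset) auto
next
  fix c and v :: "'x \<Rightarrow> 'k" assume "v \<in> fin_supp"
  then show "ksc c v \<in> fin_supp" unfolding fin_supp_def ksc_def mem_Collect_eq
    by (rule rev_finite_subset) auto
qed

lemma dlt_fin_supp [simp]: "dlt a \<in> fin_supp"
  by (simp add: fin_supp_def dlt_def)

lemma fin_supp_0 [simp]: "0 \<in> fin_supp"
  by (rule kv.subspace_0[OF subspace_fin_supp])

lemma fin_supp_neg [simp]: "v \<in> fin_supp \<Longrightarrow> - v \<in> fin_supp"
  by (rule kv.subspace_neg[OF subspace_fin_supp])

text \<open>The maps \<^const>\<open>lin_ext\<close> are additive only on finitely supported vectors,
  since the defining sum is \<open>0\<close> over an infinite support.\<close>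

definition fs_linear :: "(('x \<Rightarrow> 'k::field) \<Rightarrow> ('y \<Rightarrow> 'k)) \<Rightarrow> bool" where
  "fs_linear \<phi> \<longleftrightarrow> (\<forall>u\<in>fin_supp. \<forall>v\<in>fin_supp. \<phi> (u + v) = \<phi> u + \<phi> v) \<and>
     (\<forall>c. \<forall>v\<in>fin_supp. \<phi> (ksc c v) = ksc c (\<phi> v))"

lemma fs_linear_add: "fs_linear \<phi> \<Longrightarrow> u \<in> fin_supp \<Longrightarrow> v \<in> fin_supp \<Longrightarrow> \<phi> (u + v) = \<phi> u + \<phi> v"
  and fs_linear_scale: "fs_linear \<phi> \<Longrightarrow> v \<in> fin_supp \<Longrightarrow> \<phi> (ksc c v) = ksc c (\<phi> v)"
  by (auto simp: fs_linear_def)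

lemma fs_linear_zero: "fs_linear \<phi> \<Longrightarrow> \<phi> 0 = 0"
  using fs_linear_scale[of \<phi> 0 0] kv.subspace_0[OF subspace_fin_supp] by simp

lemma fs_linear_neg: "fs_linear \<phi> \<Longrightarrow> v \<in> fin_supp \<Longrightarrow> \<phi> (- v) = - \<phi> v"
  using fs_linear_scale[of \<phi> v "-1"] by simp

lemma fs_linear_diff:
  assumes "fs_linear \<phi>" "u \<in> fin_supp" "v \<in> fin_supp"
  shows "\<phi> (u - v) = \<phi> u - \<phi> v"
  using fs_linear_add[OF assms(1,2), of "- v"] fs_linear_neg[OF assms(1,3)] assms(3)
  by (simp add: kv.subspace_neg)

lemma lin_ext_finite:
  assumes "finite A" "{x. v x \<noteq> 0} \<subseteq> A"
  shows "lin_ext h v = (\<lambda>y. \<Sum>x\<in>A. v x * h x y)"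
  unfolding lin_ext_def using assms by (intro ext sum.mono_neutral_left) auto

lemma fs_linear_lin_ext [simp]:
  fixes h :: "'x \<Rightarrow> ('y \<Rightarrow> 'k::field)"
  shows "fs_linear (lin_ext h)"
  unfolding fs_linear_def
proof (intro conjI ballI allI)
  fix u v :: "'x \<Rightarrow> 'k" assume uv: "u \<in> fin_supp" "v \<in> fin_supp"
  define A where "A = {x. u x \<noteq> 0} \<union> {x. v x \<noteq> 0}"
  have "finite A" using uv by (simp add: A_def fin_supp_def)
  moreover have "{x. u x \<noteq> 0} \<subseteq> A" "{x. v x \<noteq> 0} \<subseteq> A" "{x. (u + v) x \<noteq> 0} \<subseteq> A"
    by (auto simp: A_def)
  ultimately have "lin_ext h u = (\<lambda>y. \<Sum>x\<in>A. u x * h x y)" "lin_ext h v = (\<lambda>y. \<Sum>x\<in>A. v x * h x y)"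
    "lin_ext h (u + v) = (\<lambda>y. \<Sum>x\<in>A. (u + v) x * h x y)"
    by (blast intro: lin_ext_finite)+
  then show "lin_ext h (u + v) = lin_ext h u + lin_ext h v"
    by (simp only: fun_eq_iff plus_fun_apply distrib_right sum.distrib) simp
next
  fix c and v :: "'x \<Rightarrow> 'k" assume v: "v \<in> fin_supp"
  then have "finite {x. v x \<noteq> 0}" by (simp add: fin_supp_def)
  moreover have "{x. ksc c v x \<noteq> 0} \<subseteq> {x. v x \<noteq> 0}" by (auto simp: ksc_def)
  ultimately have "lin_ext h (ksc c v) = (\<lambda>y. \<Sum>x\<in>{x. v x \<noteq> 0}. ksc c v x * h x y)"
    by (rule lin_ext_finite)
  then show "lin_ext h (ksc c v) = ksc c (lin_ext h v)"
    by (simp add: lin_ext_def fun_eq_iff sum_distrib_left mult.assoc ksc_def)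
qed

lemma lin_ext_dlt [simp]: "lin_ext h (dlt a) = h a"
  by (subst lin_ext_finite[of "{a}"]) (auto simp: dlt_def)

lemma fs_linear_id: "fs_linear (\<lambda>v. v)"
  by (simp add: fs_linear_def)

lemma fs_linear_minus: "fs_linear \<phi> \<Longrightarrow> fs_linear \<psi> \<Longrightarrow> fs_linear (\<lambda>v. \<phi> v - \<psi> v)"
  by (simp add: fs_linear_def add_diff_add kv.scale_right_diff_distrib)

lemma fs_linear_plus: "fs_linear \<phi> \<Longrightarrow> fs_linear \<psi> \<Longrightarrow> fs_linear (\<lambda>v. \<phi> v + \<psi> v)"
  by (simp add: fs_linear_def add.assoc add.left_commute kv.scale_right_distrib)

lemma fs_linear_ksc: "fs_linear (ksc c)"
  by (auto simp: fs_linear_def kv.scale_right_distrib mult.commute)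

text \<open>The outer map is additive only on finitely supported vectors, so the values of the inner
  one must be finitely supported. Lemmas such as \<open>p1_fin_supp\<close> and
  \<open>M_fin_supp\<close> serve this hypothesis.\<close>

lemma fs_linear_comp:
  "fs_linear \<phi> \<Longrightarrow> fs_linear \<psi> \<Longrightarrow> (\<And>v. v \<in> fin_supp \<Longrightarrow> \<phi> v \<in> fin_supp) \<Longrightarrow> fs_linear (\<lambda>v. \<psi> (\<phi> v))"
  by (simp add: fs_linear_def)

lemma lin_ext_fin_supp:
  fixes h :: "'x \<Rightarrow> ('y \<Rightarrow> 'k::field)"
  assumes "\<And>a. h a \<in> fin_supp"
  shows "lin_ext h v \<in> fin_supp"
proof -
  have "lin_ext h v = (\<Sum>x\<in>{x. v x \<noteq> 0}. ksc (v x) (h x))"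
    by (simp add: lin_ext_def fun_eq_iff sum_apply ksc_def)
  then show "lin_ext h v \<in> fin_supp"
    by (simp add: kv.subspace_sum kv.subspace_scale assms)
qed

lemma fs_linear_comp_lin_ext:
  assumes "fs_linear \<psi>" "\<And>a. h a \<in> fin_supp"
  shows "fs_linear (\<lambda>v. \<psi> (lin_ext h v))"
  by (rule fs_linear_comp[OF fs_linear_lin_ext assms(1) lin_ext_fin_supp]) (rule assms(2))

text \<open>The main device for checking a map on generators only. Since \<open>\<phi>\<close> is
  additive only on \<open>fin_supp\<close>, the preimage of \<open>B\<close> need not be a subspace,
  but its intersection with \<open>fin_supp\<close> is one.\<close>

lemma fs_linear_kspan:
  fixes \<phi> :: "('x \<Rightarrow> 'k::field) \<Rightarrow> ('y \<Rightarrow> 'k)"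
  assumes "fs_linear \<phi>" "kv.subspace B" "G \<subseteq> fin_supp" "\<And>g. g \<in> G \<Longrightarrow> \<phi> g \<in> B" "v \<in> kspan G"
  shows "\<phi> v \<in> B"
proof -
  have F: "kv.subspace (fin_supp :: ('x \<Rightarrow> 'k) set)" by simp
  have "kv.subspace {v \<in> fin_supp. \<phi> v \<in> B}"
    using kv.subspace_0[OF assms(2)] kv.subspace_add[OF assms(2)] kv.subspace_scale[OF assms(2)]
      kv.subspace_0[OF F] kv.subspace_add[OF F] kv.subspace_scale[OF F]
    by (intro kv.subspaceI) (simp_all only: mem_Collect_eq fs_linear_add[OF assms(1)]
        fs_linear_scale[OF assms(1)] fs_linear_zero[OF assms(1)])
  then have "kspan G \<subseteq> {v \<in> fin_supp. \<phi> v \<in> B}"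
    using assms(3,4) by (intro kspan_subset) auto
  then show ?thesis using assms(5) by auto
qed

interpretation kvp: vector_space_pair
  "ksc :: 'k::field \<Rightarrow> ('x \<Rightarrow> 'k) \<Rightarrow> ('x \<Rightarrow> 'k)" "ksc :: 'k::field \<Rightarrow> ('y \<Rightarrow> 'k) \<Rightarrow> ('y \<Rightarrow> 'k)"
  by unfold_locales

text \<open>Over a field every subspace has a complement; here this takes the form of a left
  inverse, on \<open>U\<close>, of the identity map.\<close>

lemma projection_onto_subspace:
  fixes U :: "('x \<Rightarrow> 'k::field) set"
  assumes "kv.subspace U"
  obtains P where "\<And>u v. P (u + v) = P u + P v" "\<And>c v. P (ksc c v) = ksc c (P v)"
    "\<And>v. P v \<in> U" "\<And>v. v \<in> U \<Longrightarrow> P v = v"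
proof -
  have "Vector_Spaces.linear ksc ksc (\<lambda>v :: 'x \<Rightarrow> 'k. v)"
    by (rule kv.linear_ident)
  from kvp.linear_exists_left_inverse_on[OF this assms]
  obtain P :: "('x \<Rightarrow> 'k) \<Rightarrow> ('x \<Rightarrow> 'k)" where P: "P ` UNIV \<subseteq> U" "Vector_Spaces.linear ksc ksc P" "\<forall>v\<in>U. P v = v"
    by auto
  interpret P: Vector_Spaces.linear ksc ksc P by (rule P(2))
  show ?thesis
    by (rule that[of P]) (use P(1,3) P.add P.scale in auto)
qed

text \<open>Injectivity: \<open>v\<close> is \<open>\<psi> (\<phi> v)\<close> minus an error in
  \<open>B1\<close>, and \<open>\<psi>\<close> carries \<open>B2\<close> into \<open>B1\<close>.
  Surjectivity: \<open>\<psi> w\<close> is a preimage of \<open>w\<close> up to \<open>B2\<close>.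
  Both round trips are needed only modulo relations, which suits a \<open>\<psi>\<close> built from
  chosen representatives.\<close>

lemma induces_iso_by_inverse:
  assumes \<phi>: "fs_linear \<phi>" and B: "kv.subspace B1" "kv.subspace B2"
    and fs: "A1 \<subseteq> fin_supp" "A2 \<subseteq> fin_supp"
    and \<phi>A: "\<And>v. v \<in> A1 \<Longrightarrow> \<phi> v \<in> A2" and \<phi>B: "\<And>v. v \<in> B1 \<Longrightarrow> \<phi> v \<in> B2"
    and \<psi>A: "\<And>v. v \<in> A2 \<Longrightarrow> \<psi> v \<in> A1" and \<psi>B: "\<And>v. v \<in> B2 \<Longrightarrow> \<psi> v \<in> B1"
    and \<psi>\<phi>: "\<And>v. v \<in> A1 \<Longrightarrow> \<psi> (\<phi> v) - v \<in> B1"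
    and \<phi>\<psi>: "\<And>w. w \<in> A2 \<Longrightarrow> \<phi> (\<psi> w) - w \<in> B2"
  shows "induces_iso \<phi> A1 B1 A2 B2"
  unfolding induces_iso_def
proof (intro conjI ballI impI)
  fix v assume v: "v \<in> A1" "\<phi> v \<in> B2"
  then have "\<psi> (\<phi> v) - (\<psi> (\<phi> v) - v) \<in> B1"
    by (intro kv.subspace_diff[OF B(1)] \<psi>B \<psi>\<phi>)
  then show "v \<in> B1" by simp
next
  fix w assume w: "w \<in> A2"
  have "- (\<phi> (\<psi> w) - w) \<in> B2" by (intro kv.subspace_neg[OF B(2)] \<phi>\<psi> w)
  moreover have "- (\<phi> (\<psi> w) - w) = (\<lambda>y. w y - \<phi> (\<psi> w) y)" by (simp add: fun_eq_iff)
  ultimately have "(\<lambda>y. w y - \<phi> (\<psi> w) y) \<in> B2" by simp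
  then show "\<exists>v\<in>A1. (\<lambda>y. w y - \<phi> v y) \<in> B2" using \<psi>A[OF w] by blast
qed (use \<phi>A \<phi>B in auto)

section \<open>Classes and congruences modulo a subspace\<close>

lemma cls_eq_iff:
  assumes "kv.subspace N"
  shows "cls N u = cls N v \<longleftrightarrow> u - v \<in> N"
proof
  have cls: "cls N v = {v + w | w. w \<in> N}" for v by (simp add: cls_def plus_fun_def)
  { assume "cls N u = cls N v"
    moreover have "u \<in> cls N u" using kv.subspace_0[OF assms] by (force simp: cls)
    ultimately show "u - v \<in> N" by (auto simp: cls) }
  assume uv: "u - v \<in> N"
  have "u + w \<in> cls N v" if "w \<in> N" for w
    using kv.subspace_add[OF assms uv that] by (auto simp: cls intro!: exI[of _ "u - v + w"])
  moreover have "v + w \<in> cls N u" if "w \<in> N" for w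
    using kv.subspace_diff[OF assms that uv] by (auto simp: cls intro!: exI[of _ "w - (u - v)"])
  ultimately show "cls N u = cls N v" by (auto simp: cls[of u] cls[of v])
qed

lemma rp_cls:
  assumes "kv.subspace N"
  shows "rp (cls N v) - v \<in> N"
proof -
  have "v \<in> cls N v" using kv.subspace_0[OF assms] by (force simp: cls_def zero_fun_def)
  then have "rp (cls N v) \<in> cls N v" unfolding rp_def by (rule someI[of "\<lambda>v. v \<in> _"])
  then show ?thesis by (auto simp: cls_def fun_diff_def)
qed

text \<open>A relation of its own, so that the relations of a module can be chained, added and
  scaled like equations; the difference reappears only at the ends of a calculation.\<close>

definition cong_mod :: "('x \<Rightarrow> 'k::field) set \<Rightarrow> ('x \<Rightarrow> 'k) \<Rightarrow> ('x \<Rightarrow> 'k) \<Rightarrow> bool" where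
  "cong_mod N u v \<longleftrightarrow> u - v \<in> N"

context
  fixes N :: "('x \<Rightarrow> 'k::field) set"
  assumes N: "kv.subspace N"
begin

lemma cong_mod_refl: "cong_mod N u u"
  using kv.subspace_0[OF N] by (simp only: cong_mod_def diff_self)

lemma cong_mod_sym: "cong_mod N u v \<Longrightarrow> cong_mod N v u"
  using kv.subspace_neg[OF N, of "u - v"] by (simp only: cong_mod_def minus_diff_eq)

lemma cong_mod_trans: "cong_mod N u v \<Longrightarrow> cong_mod N v w \<Longrightarrow> cong_mod N u w"
  using kv.subspace_add[OF N, of "u - v" "v - w"] by (simp only: cong_mod_def diff_add_cancel add_diff_eq)

lemma cong_mod_add: "cong_mod N u v \<Longrightarrow> cong_mod N u' v' \<Longrightarrow> cong_mod N (u + u') (v + v')"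
  using kv.subspace_add[OF N, of "u - v" "u' - v'"] by (simp only: cong_mod_def add_diff_add)

lemma cong_mod_minus: "cong_mod N u v \<Longrightarrow> cong_mod N (- u) (- v)"
  using kv.subspace_neg[OF N, of "u - v"] by (simp only: cong_mod_def minus_diff_minus)

lemma cong_mod_diff: "cong_mod N u v \<Longrightarrow> cong_mod N u' v' \<Longrightarrow> cong_mod N (u - u') (v - v')"
  using cong_mod_add[OF _ cong_mod_minus, of u v u' v'] by (simp only: diff_conv_add_uminus)

lemma cong_mod_scale: "cong_mod N u v \<Longrightarrow> cong_mod N (ksc c u) (ksc c v)"
  using kv.subspace_scale[OF N, of "u - v" c] by (simp only: cong_mod_def kv.scale_right_diff_distrib)

lemma cong_mod_0: "cong_mod N u 0 \<longleftrightarrow> u \<in> N"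
  by (simp only: cong_mod_def diff_0_right)

lemma cong_mod_mem: "cong_mod N u v \<Longrightarrow> v \<in> N \<Longrightarrow> u \<in> N"
  using cong_mod_trans[of u v 0] by (simp only: cong_mod_0)

lemma cls_eq: "cls N u = cls N v \<longleftrightarrow> cong_mod N u v"
  using cls_eq_iff[OF N] by (simp only: cong_mod_def)

lemma rp_cls_cong: "cong_mod N (rp (cls N v)) v"
  using rp_cls[OF N] by (simp only: cong_mod_def)

lemma cong_mod_kspan:
  fixes \<phi> :: "('y \<Rightarrow> 'k) \<Rightarrow> ('x \<Rightarrow> 'k)"
  assumes "fs_linear \<phi>" "fs_linear \<psi>" "G \<subseteq> fin_supp" "\<And>g. g \<in> G \<Longrightarrow> cong_mod N (\<phi> g) (\<psi> g)" "v \<in> kspan G"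
  shows "cong_mod N (\<phi> v) (\<psi> v)"
  using fs_linear_kspan[OF fs_linear_minus[OF assms(1,2)] N assms(3) _ assms(5)] assms(4)
  by (simp only: cong_mod_def)

end

text \<open>Reads the three-term generators \<open>u - v - w\<close> of the relation spaces as rules
  \<open>u = v + w\<close>.\<close>

lemma cong_mod_diff2:
  "cong_mod N u (v + w) \<longleftrightarrow> u - v - w \<in> N"
  by (simp only: cong_mod_def diff_diff_eq)

text \<open>The universal property of the tensor product, for a map given on the free space: being
  balanced and bilinear modulo \<open>T\<close> is what it takes to factor through the
  quotient.\<close>

lemma tens_rel_map:
  fixes \<iota> :: "'k::field \<Rightarrow> 'b" and \<phi> :: "('m \<times> 'n \<Rightarrow> 'k) \<Rightarrow> ('y \<Rightarrow> 'k)"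
  assumes \<phi>: "fs_linear \<phi>" and T: "kv.subspace T"
    and "\<And>m m' n. m \<in> Mc \<Longrightarrow> m' \<in> Mc \<Longrightarrow> n \<in> Nc \<Longrightarrow>
      cong_mod T (\<phi> (dlt (addM m m', n))) (\<phi> (dlt (m, n)) + \<phi> (dlt (m', n)))"
    and "\<And>m n n'. m \<in> Mc \<Longrightarrow> n \<in> Nc \<Longrightarrow> n' \<in> Nc \<Longrightarrow>
      cong_mod T (\<phi> (dlt (m, addN n n'))) (\<phi> (dlt (m, n)) + \<phi> (dlt (m, n')))"
    and "\<And>b m n. b \<in> carrier B \<Longrightarrow> m \<in> Mc \<Longrightarrow> n \<in> Nc \<Longrightarrow>
      cong_mod T (\<phi> (dlt (actM b m, n))) (\<phi> (dlt (m, actN b n)))"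
    and "\<And>e m n. m \<in> Mc \<Longrightarrow> n \<in> Nc \<Longrightarrow>
      cong_mod T (\<phi> (dlt (actM (\<iota> e) m, n))) (ksc e (\<phi> (dlt (m, n))))"
    and v: "v \<in> tens_rel B \<iota> Mc addM actM Nc addN actN"
  shows "\<phi> v \<in> T"
proof (rule fs_linear_kspan[OF \<phi> T _ _ v[unfolded tens_rel_def]])
  note fs = kv.subspace_diff[OF subspace_fin_supp] kv.subspace_scale[OF subspace_fin_supp] dlt_fin_supp
  note lin = fs_linear_diff[OF \<phi>] fs_linear_scale[OF \<phi>]
  fix g assume "g \<in> {dlt (addM m m', n) - dlt (m, n) - dlt (m', n) | m m' n. m \<in> Mc \<and> m' \<in> Mc \<and> n \<in> Nc}
     \<union> {dlt (m, addN n n') - dlt (m, n) - dlt (m, n') | m n n'. m \<in> Mc \<and> n \<in> Nc \<and> n' \<in> Nc}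
     \<union> {dlt (actM b m, n) - dlt (m, actN b n) | b m n. b \<in> carrier B \<and> m \<in> Mc \<and> n \<in> Nc}
     \<union> {dlt (actM (\<iota> e) m, n) - ksc e (dlt (m, n)) | e m n. m \<in> Mc \<and> n \<in> Nc}"
  then show "\<phi> g \<in> T"
    using assms(3-6)
    by (elim UnE CollectE exE conjE) (simp_all only: lin fs cong_mod_diff2, simp_all only: cong_mod_def)
qed (auto intro!: kv.subspace_diff[OF subspace_fin_supp] kv.subspace_scale[OF subspace_fin_supp])

lemma subspace_tens_rel [simp]: "kv.subspace (tens_rel B \<iota> Mc addM actM Nc addN actN)"
  by (simp add: tens_rel_def)

lemma tens_rel_cong:
  fixes \<iota> :: "'k::field \<Rightarrow> 'b"
  assumes T: "T = tens_rel B \<iota> Mc addM actM Nc addN actN"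
  shows "m \<in> Mc \<Longrightarrow> m' \<in> Mc \<Longrightarrow> n \<in> Nc \<Longrightarrow>
      cong_mod T (dlt (addM m m', n)) (dlt (m, n) + dlt (m', n))"
    and "m \<in> Mc \<Longrightarrow> n \<in> Nc \<Longrightarrow> n' \<in> Nc \<Longrightarrow>
      cong_mod T (dlt (m, addN n n')) (dlt (m, n) + dlt (m, n'))"
    and "b \<in> carrier B \<Longrightarrow> m \<in> Mc \<Longrightarrow> n \<in> Nc \<Longrightarrow>
      cong_mod T (dlt (actM b m, n)) (dlt (m, actN b n))"
    and "m \<in> Mc \<Longrightarrow> n \<in> Nc \<Longrightarrow>
      cong_mod T (dlt (actM (\<iota> e) m, n)) (ksc e (dlt (m, n)))"
  unfolding cong_mod_diff2 unfolding cong_mod_def T tens_rel_def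
  by (rule kspan_base; blast)+

section \<open>Kaehler differentials\<close>

text \<open>A locale because it is used twice: as \<open>KS\<close> for \<open>S\<close> over
  \<open>R\<close> and as \<open>KQ\<close> for \<open>S/J\<close> over \<open>R/I\<close>.\<close>

locale kahler_data = cring B for B :: "'b ring" (structure) +
  fixes \<iota> :: "'k::field \<Rightarrow> 'b" and A :: "'a ring" and g :: "'a \<Rightarrow> 'b"
  assumes \<iota>_hom: "\<iota> \<in> ring_hom kring B"
    and g_closed: "a \<in> carrier A \<Longrightarrow> g a \<in> carrier B"
begin

lemma \<iota>_closed [simp]: "\<iota> e \<in> carrier B"
  using \<iota>_hom by (auto simp: ring_hom_def kring_def)

abbreviation "K \<equiv> kahler_rel B \<iota> A g"

definition C :: "('b \<times> 'b \<Rightarrow> 'k) set" where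
  "C = kspan {dlt (b, c) | b c. b \<in> carrier B \<and> c \<in> carrier B}"

text \<open>Multiplication by \<open>s\<close> on symbols \<open>b dc\<close>. Differentials and
  elements of \<open>S \<otimes> S\<close> are both encoded as functions on pairs, so for
  \<open>x\<close> in \<open>J\<close> the same formula, with the result \<open>(xb, c)\<close> read
  as \<open>xb \<otimes> c\<close>, also gives the inverse of the first isomorphism.\<close>

definition mu :: "'b \<Rightarrow> ('b \<times> 'b \<Rightarrow> 'k) \<Rightarrow> ('b \<times> 'b \<Rightarrow> 'k)" where
  "mu s = lin_ext (\<lambda>(b, c). dlt (s \<otimes> b, c))"

lemma subspace_K [simp]: "kv.subspace K"
  by (simp add: kahler_rel_def)

lemma subspace_C [simp]: "kv.subspace C"
  by (simp add: C_def)

lemma dlt_in_C [simp]: "b \<in> carrier B \<Longrightarrow> c \<in> carrier B \<Longrightarrow> dlt (b, c) \<in> C"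
  unfolding C_def by (rule kspan_base) blast

lemma C_fin_supp: "C \<subseteq> fin_supp"
  unfolding C_def by (rule kspan_subset) auto

lemma fs_linear_C:
  assumes "fs_linear \<phi>" "kv.subspace T"
    "\<And>b c. b \<in> carrier B \<Longrightarrow> c \<in> carrier B \<Longrightarrow> \<phi> (dlt (b, c)) \<in> T" "v \<in> C"
  shows "\<phi> v \<in> T"
  by (rule fs_linear_kspan[OF assms(1,2) _ _ assms(4)[unfolded C_def]]) (use assms(3) in auto)

lemma cong_mod_C:
  assumes "kv.subspace T" "fs_linear \<phi>" "fs_linear \<psi>"
    "\<And>b c. b \<in> carrier B \<Longrightarrow> c \<in> carrier B \<Longrightarrow> cong_mod T (\<phi> (dlt (b, c))) (\<psi> (dlt (b, c)))" "v \<in> C"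
  shows "cong_mod T (\<phi> v) (\<psi> v)"
  by (rule cong_mod_kspan[OF assms(1-3) _ _ assms(5)[unfolded C_def]]) (use assms(4) in auto)

lemma K_cong:
  "b \<in> carrier B \<Longrightarrow> b' \<in> carrier B \<Longrightarrow> c \<in> carrier B \<Longrightarrow>
     cong_mod K (dlt (b \<oplus> b', c)) (dlt (b, c) + dlt (b', c))"
  "b \<in> carrier B \<Longrightarrow> c \<in> carrier B \<Longrightarrow> cong_mod K (dlt (\<iota> e \<otimes> b, c)) (ksc e (dlt (b, c)))"
  "b \<in> carrier B \<Longrightarrow> c \<in> carrier B \<Longrightarrow> c' \<in> carrier B \<Longrightarrow>
     cong_mod K (dlt (b, c \<oplus> c')) (dlt (b, c) + dlt (b, c'))"
  "b \<in> carrier B \<Longrightarrow> c \<in> carrier B \<Longrightarrow> c' \<in> carrier B \<Longrightarrow>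
     cong_mod K (dlt (b, c \<otimes> c')) (dlt (b \<otimes> c, c') + dlt (b \<otimes> c', c))"
  "b \<in> carrier B \<Longrightarrow> a \<in> carrier A \<Longrightarrow> dlt (b, g a) \<in> K"
  unfolding cong_mod_diff2 unfolding cong_mod_def kahler_rel_def
  by (rule kspan_base; blast)+

text \<open>The universal property of the Kaehler differentials on the level of the free space: a
  map that obeys the rules of a derivation trivial on \<open>A\<close>, with a free coefficient
  \<open>b\<close>, kills all relations.\<close>

lemma K_map:
  assumes \<phi>: "fs_linear \<phi>" and T: "kv.subspace T"
    and "\<And>b b' c. b \<in> carrier B \<Longrightarrow> b' \<in> carrier B \<Longrightarrow> c \<in> carrier B \<Longrightarrow>
     cong_mod T (\<phi> (dlt (b \<oplus> b', c))) (\<phi> (dlt (b, c)) + \<phi> (dlt (b', c)))"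
    "\<And>e b c. b \<in> carrier B \<Longrightarrow> c \<in> carrier B \<Longrightarrow> cong_mod T (\<phi> (dlt (\<iota> e \<otimes> b, c))) (ksc e (\<phi> (dlt (b, c))))"
    "\<And>b c c'. b \<in> carrier B \<Longrightarrow> c \<in> carrier B \<Longrightarrow> c' \<in> carrier B \<Longrightarrow>
     cong_mod T (\<phi> (dlt (b, c \<oplus> c'))) (\<phi> (dlt (b, c)) + \<phi> (dlt (b, c')))"
    "\<And>b c c'. b \<in> carrier B \<Longrightarrow> c \<in> carrier B \<Longrightarrow> c' \<in> carrier B \<Longrightarrow>
     cong_mod T (\<phi> (dlt (b, c \<otimes> c'))) (\<phi> (dlt (b \<otimes> c, c')) + \<phi> (dlt (b \<otimes> c', c)))"
    "\<And>b a. b \<in> carrier B \<Longrightarrow> a \<in> carrier A \<Longrightarrow> \<phi> (dlt (b, g a)) \<in> T"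
    and v: "v \<in> K"
  shows "\<phi> v \<in> T"
proof (rule fs_linear_kspan[OF \<phi> T _ _ v[unfolded kahler_rel_def]])
  note fs = kv.subspace_diff[OF subspace_fin_supp] kv.subspace_scale[OF subspace_fin_supp] dlt_fin_supp
  note lin = fs_linear_diff[OF \<phi>] fs_linear_scale[OF \<phi>]
  fix w assume "w \<in> {dlt (b \<oplus> b', c) - dlt (b, c) - dlt (b', c) | b b' c.
        b \<in> carrier B \<and> b' \<in> carrier B \<and> c \<in> carrier B}
   \<union> {dlt (\<iota> e \<otimes> b, c) - ksc e (dlt (b, c)) | e b c. b \<in> carrier B \<and> c \<in> carrier B}
   \<union> {dlt (b, c \<oplus> c') - dlt (b, c) - dlt (b, c') | b c c'.
        b \<in> carrier B \<and> c \<in> carrier B \<and> c' \<in> carrier B}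
   \<union> {dlt (b, c \<otimes> c') - dlt (b \<otimes> c, c') - dlt (b \<otimes> c', c) | b c c'.
        b \<in> carrier B \<and> c \<in> carrier B \<and> c' \<in> carrier B}
   \<union> {dlt (b, g a) | b a. b \<in> carrier B \<and> a \<in> carrier A}"
  then show "\<phi> w \<in> T"
    using assms(3-7)
    by (elim UnE CollectE exE conjE) (simp_all only: lin fs cong_mod_diff2, simp_all only: cong_mod_def)
qed (auto intro!: kv.subspace_diff[OF subspace_fin_supp] kv.subspace_scale[OF subspace_fin_supp])

lemma K_subset_C: "K \<subseteq> C"
  unfolding kahler_rel_def
  by (rule kspan_subset)
    (auto intro!: kv.subspace_diff[OF subspace_C] kv.subspace_scale[OF subspace_C] simp: g_closed)

lemma fs_linear_mu [simp]: "fs_linear (mu s)"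
  by (simp add: mu_def)

lemma mu_dlt [simp]: "mu s (dlt (b, c)) = dlt (s \<otimes> b, c)"
  by (simp add: mu_def)

lemma mu_C: "s \<in> carrier B \<Longrightarrow> v \<in> C \<Longrightarrow> mu s v \<in> C"
  by (rule fs_linear_C[of "mu s"]) auto

text \<open>\<open>K\<close> is only a \<open>k\<close>-span, but each of its generators has an
  arbitrary coefficient \<open>b\<close>. Replacing \<open>b\<close> by \<open>s \<otimes> b\<close>
  gives a generator of the same kind, so \<open>K\<close> is a submodule over
  \<open>B\<close>.\<close>

lemma mu_K:
  assumes s: "s \<in> carrier B" and v: "v \<in> K"
  shows "mu s v \<in> K"
proof (rule K_map[OF fs_linear_mu subspace_K _ _ _ _ _ v])
  fix e b c assume bc: "b \<in> carrier B" "c \<in> carrier B"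
  have "s \<otimes> (\<iota> e \<otimes> b) = \<iota> e \<otimes> (s \<otimes> b)" using bc s by (simp add: m_lcomm)
  then show "cong_mod K (mu s (dlt (\<iota> e \<otimes> b, c))) (ksc e (mu s (dlt (b, c))))"
    using K_cong(2)[of "s \<otimes> b" c e] bc s by simp
next
  fix b c c' assume bc: "b \<in> carrier B" "c \<in> carrier B" "c' \<in> carrier B"
  show "cong_mod K (mu s (dlt (b, c \<otimes> c'))) (mu s (dlt (b \<otimes> c, c')) + mu s (dlt (b \<otimes> c', c)))"
    using K_cong(4)[of "s \<otimes> b" c c'] bc s by (simp add: m_assoc)
qed (use s K_cong in \<open>auto simp: r_distr\<close>)

lemma mu_cong:
  assumes "s \<in> carrier B" "cong_mod K u v" "u \<in> C" "v \<in> C"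
  shows "cong_mod K (mu s u) (mu s v)"
proof -
  have "mu s (u - v) = mu s u - mu s v"
    using assms C_fin_supp by (intro fs_linear_diff[OF fs_linear_mu]) auto
  then show ?thesis using mu_K[OF assms(1), of "u - v"] assms(2) by (simp only: cong_mod_def)
qed

lemma mu_\<iota>: "v \<in> C \<Longrightarrow> cong_mod K (mu (\<iota> e) v) (ksc e v)"
  by (rule cong_mod_C[OF subspace_K fs_linear_mu fs_linear_ksc]) (auto intro: K_cong)

lemma cls_in_kahler: "v \<in> C \<Longrightarrow> cls K v \<in> kahler B \<iota> A g"
  by (auto simp: kahler_def C_def)

lemma cong_K_C: "cong_mod K u v \<Longrightarrow> v \<in> C \<Longrightarrow> u \<in> C"
  using K_subset_C kv.subspace_add[OF subspace_C, of "u - v" v] by (auto simp only: cong_mod_def diff_add_cancel)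

lemma rp_cls_C: "v \<in> C \<Longrightarrow> rp (cls K v) \<in> C"
  using cong_K_C[OF rp_cls_cong[OF subspace_K]] .

lemma kahler_cases:
  assumes "\<omega> \<in> kahler B \<iota> A g"
  obtains v where "v \<in> C" "\<omega> = cls K v"
  using assms by (auto simp: kahler_def C_def)

text \<open>The operations on classes are defined through \<open>rp\<close>; from here on they can
  be computed with any representative.\<close>

lemma kahler_add_cls: "kahler_add B \<iota> A g (cls K u) (cls K v) = cls K (u + v)"
  unfolding kahler_add_def by (subst cls_eq) (auto intro!: cong_mod_add rp_cls_cong)

lemma kahler_act_cls: "s \<in> carrier B \<Longrightarrow> v \<in> C \<Longrightarrow> kahler_act B \<iota> A g s (cls K v) = cls K (mu s v)"
  unfolding kahler_act_def mu_def[symmetric]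
  by (subst cls_eq) (auto intro!: mu_cong rp_cls_cong rp_cls_C)

end

section \<open>The setting, and pure tensors in the module of differentials tensored with J\<close>

locale excision_data = S: cring S for S :: "'s ring" (structure) +
  fixes R :: "'r ring" and \<iota>R :: "'k::field \<Rightarrow> 'r" and \<iota>S :: "'k \<Rightarrow> 's"
    and f :: "'r \<Rightarrow> 's" and I :: "'r set" and J :: "'s set"
  assumes J_eq: "J = f ` I" and R: "cring R" and \<iota>R: "\<iota>R \<in> ring_hom kring R"
    and \<iota>S: "\<iota>S \<in> ring_hom kring S" and f_\<iota>: "f (\<iota>R e) = \<iota>S e"
    and f: "f \<in> ring_hom R S"
    and I: "ideal I R" and ideal_J: "ideal J S"
begin

lemma f_closed [simp]: "a \<in> carrier R \<Longrightarrow> f a \<in> carrier S"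
  using f by (rule ring_hom_closed)

sublocale KS: kahler_data S \<iota>S R f
  by unfold_locales (simp_all add: \<iota>S)

lemma I_carrier: "I \<subseteq> carrier R"
  using ideal.axioms(1)[OF I] by (auto dest: additive_subgroup.a_subset)

sublocale J: ideal J S
  by (rule ideal_J)

lemma J_carrier [simp]: "x \<in> J \<Longrightarrow> x \<in> carrier S"
  by (rule J.Icarr)

lemma dJ_K: "b \<in> carrier S \<Longrightarrow> j \<in> J \<Longrightarrow> dlt (b, j) \<in> KS.K"
  using KS.K_cong(5)[of b] I_carrier by (auto simp: J_eq)

text \<open>\<open>J\<close> kills \<open>\<Omega>\<close>: both \<open>j\<close> and \<open>j c\<close> lie in the image of \<open>R\<close>, so
  \<open>j dc = d(j c) - c dj = 0\<close>.\<close>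
lemma J_kills_K:
  assumes "j \<in> J" "c \<in> carrier S"
  shows "dlt (j, c) \<in> KS.K"
proof -
  define u v w :: "'s \<times> 's \<Rightarrow> 'k"
    where "u = dlt (\<one>, j \<otimes> c)" "v = dlt (\<one> \<otimes> j, c)" "w = dlt (\<one> \<otimes> c, j)"
  have "cong_mod KS.K u (v + w)"
    unfolding u_v_w_def using assms by (intro KS.K_cong(4)) auto
  then have c: "u - (v + w) \<in> KS.K" by (simp only: cong_mod_def)
  have uw: "u \<in> KS.K" "w \<in> KS.K"
    unfolding u_v_w_def using assms by (auto intro!: dJ_K J.I_r_closed)
  have "u - w - (u - (v + w)) \<in> KS.K"
    by (rule kv.subspace_diff[OF KS.subspace_K kv.subspace_diff[OF KS.subspace_K uw] c])
  moreover have "u - w - (u - (v + w)) = v" by (simp add: algebra_simps)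
  ultimately have "v \<in> KS.K" by (simp only:)
  then show ?thesis using assms by (simp add: u_v_w_def)
qed

abbreviation "T \<equiv> IOm_rel S \<iota>S R f J"
abbreviation "\<Omega> \<equiv> kahler S \<iota>S R f"

text \<open>The pure tensor \<open>x \<otimes> [v]\<close>, indexed by a vector instead of a class.
  It depends only on the class of \<open>v\<close>, so changing \<open>v\<close> modulo
  \<open>K\<close> gives an equality, whereas additivity and scalar rules hold only modulo
  \<open>T\<close>.\<close>

definition br :: "'s \<Rightarrow> ('s \<times> 's \<Rightarrow> 'k) \<Rightarrow> ('s \<times> ('s \<times> 's \<Rightarrow> 'k) set \<Rightarrow> 'k)" where
  "br x v = dlt (x, cls KS.K v)"

lemma subspace_T [simp]: "kv.subspace T"
  by (simp add: IOm_rel_def)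

lemmas T_rel_cong = tens_rel_cong[OF IOm_rel_def[of S \<iota>S R f J]]

lemma br_cong: "cong_mod KS.K u v \<Longrightarrow> br x u = br x v"
  unfolding br_def by (metis cls_eq[OF KS.subspace_K])

lemma br_add_left: "x \<in> J \<Longrightarrow> y \<in> J \<Longrightarrow> v \<in> KS.C \<Longrightarrow> cong_mod T (br (x \<oplus> y) v) (br x v + br y v)"
  unfolding br_def by (intro T_rel_cong KS.cls_in_kahler)

lemma br_add_right: "x \<in> J \<Longrightarrow> u \<in> KS.C \<Longrightarrow> v \<in> KS.C \<Longrightarrow> cong_mod T (br x (u + v)) (br x u + br x v)"
  unfolding br_def KS.kahler_add_cls[symmetric] by (intro T_rel_cong KS.cls_in_kahler)

lemma br_mult: "x \<in> J \<Longrightarrow> s \<in> carrier S \<Longrightarrow> v \<in> KS.C \<Longrightarrow> cong_mod T (br (s \<otimes> x) v) (br x (KS.mu s v))"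
  unfolding br_def by (subst KS.kahler_act_cls[symmetric]) (auto intro!: T_rel_cong KS.cls_in_kahler)

lemma br_\<iota>: "x \<in> J \<Longrightarrow> v \<in> KS.C \<Longrightarrow> cong_mod T (br (\<iota>S e \<otimes> x) v) (ksc e (br x v))"
  unfolding br_def by (intro T_rel_cong KS.cls_in_kahler)

text \<open>The relations in \<open>tens_rel\<close> mention scalars in the left factor only. A
  scalar on the right is written as the action of \<open>\<iota>S e\<close> and moved across the
  tensor sign.\<close>

lemma br_ksc: "x \<in> J \<Longrightarrow> v \<in> KS.C \<Longrightarrow> cong_mod T (br x (ksc e v)) (ksc e (br x v))"
  using cong_mod_trans[OF subspace_T cong_mod_sym[OF subspace_T br_mult[of x "\<iota>S e" v]] br_\<iota>[of x v e]]
    br_cong[OF KS.mu_\<iota>[of v e], of x] by simp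

lemma br_0: "x \<in> J \<Longrightarrow> br x 0 \<in> T"
  using br_ksc[of x 0 0] kv.subspace_0[OF KS.subspace_C] cong_mod_0[OF subspace_T] by simp

lemma br_K: "x \<in> J \<Longrightarrow> v \<in> KS.K \<Longrightarrow> br x v \<in> T"
  using br_cong[of v 0 x] br_0 cong_mod_0[OF KS.subspace_K] by metis

lemma br_J_right: "x \<in> J \<Longrightarrow> b \<in> carrier S \<Longrightarrow> j \<in> J \<Longrightarrow> br x (dlt (b, j)) \<in> T"
  by (intro br_K dJ_K)

lemma J_kills_C:
  assumes "j \<in> J" "v \<in> KS.C" shows "KS.mu j v \<in> KS.K"
  by (rule KS.fs_linear_C[OF KS.fs_linear_mu KS.subspace_K _ assms(2)])
    (use assms(1) in \<open>auto intro!: J_kills_K J.I_r_closed\<close>)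

abbreviation "J2 \<equiv> ideal_prod S J J"

text \<open>A product moves half across: \<open>ij \<otimes> v = j \<otimes> iv\<close>, and
  \<open>iv\<close> is zero because \<open>J\<close> kills the differentials.\<close>

lemma br_J2:
  assumes "q \<in> J2" "v \<in> KS.C" shows "br q v \<in> T"
  using assms(1)
proof induction
  case (prod i j)
  have "cong_mod T (br (i \<otimes> j) v) (br j (KS.mu i v))"
    using prod assms by (intro br_mult) auto
  moreover have "br j (KS.mu i v) \<in> T" using prod assms by (intro br_K J_kills_C)
  ultimately show ?case by (rule cong_mod_mem[OF subspace_T])
next
  case (sum s t)
  have "s \<in> J" "t \<in> J" using sum(1,2) S.ideal_prod_inter[OF ideal_J ideal_J] by auto
  then have "cong_mod T (br (s \<oplus> t) v) (br s v + br t v)"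
    by (intro br_add_left assms)
  then show ?case using sum(3,4)
    by (blast intro: cong_mod_mem[OF subspace_T] kv.subspace_add[OF subspace_T])
qed

text \<open>Splits \<open>x \<otimes> [v]\<close> into the tensors \<open>x \<otimes> b dc\<close>
  of the symbols in \<open>v\<close>. As \<open>br x\<close> is linear only modulo \<open>T\<close>,
  the principle \<open>cong_mod_C\<close> does not apply to it, and the set of good \<open>v\<close>
  is shown to be a subspace directly.\<close>

lemma br_expand:
  assumes "x \<in> J" "v \<in> KS.C"
  shows "cong_mod T (lin_ext (\<lambda>p. br x (dlt p)) v) (br x v)"
proof -
  have "kv.subspace {v \<in> KS.C. cong_mod T (lin_ext (\<lambda>p. br x (dlt p)) v) (br x v)}"
  proof (rule kv.subspaceI)
    show "0 \<in> {v \<in> KS.C. cong_mod T (lin_ext (\<lambda>p. br x (dlt p)) v) (br x v)}"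
      using kv.subspace_0[OF KS.subspace_C] br_0[OF assms(1)]
      by (simp add: fs_linear_zero[OF fs_linear_lin_ext] cong_mod_sym cong_mod_0)
  next
    fix u v assume *: "u \<in> {v \<in> KS.C. cong_mod T (lin_ext (\<lambda>p. br x (dlt p)) v) (br x v)}"
      "v \<in> {v \<in> KS.C. cong_mod T (lin_ext (\<lambda>p. br x (dlt p)) v) (br x v)}"
    then have "cong_mod T (lin_ext (\<lambda>p. br x (dlt p)) (u + v)) (br x u + br x v)"
      using KS.C_fin_supp
      by (subst fs_linear_add[OF fs_linear_lin_ext]) (auto intro: cong_mod_add)
    moreover have "cong_mod T (br x u + br x v) (br x (u + v))"
      using * assms by (blast intro: cong_mod_sym[OF subspace_T] br_add_right)
    ultimately show "u + v \<in> {v \<in> KS.C. cong_mod T (lin_ext (\<lambda>p. br x (dlt p)) v) (br x v)}"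
      using * kv.subspace_add[OF KS.subspace_C] by (blast intro: cong_mod_trans[OF subspace_T])
  next
    fix c v assume *: "v \<in> {v \<in> KS.C. cong_mod T (lin_ext (\<lambda>p. br x (dlt p)) v) (br x v)}"
    then have "cong_mod T (lin_ext (\<lambda>p. br x (dlt p)) (ksc c v)) (ksc c (br x v))"
      using KS.C_fin_supp
      by (subst fs_linear_scale[OF fs_linear_lin_ext]) (auto intro: cong_mod_scale)
    moreover have "cong_mod T (ksc c (br x v)) (br x (ksc c v))"
      using * assms by (blast intro: cong_mod_sym[OF subspace_T] br_ksc)
    ultimately show "ksc c v \<in> {v \<in> KS.C. cong_mod T (lin_ext (\<lambda>p. br x (dlt p)) v) (br x v)}"
      using * kv.subspace_scale[OF KS.subspace_C] by (blast intro: cong_mod_trans[OF subspace_T])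
  qed
  then have "KS.C \<subseteq> {v \<in> KS.C. cong_mod T (lin_ext (\<lambda>p. br x (dlt p)) v) (br x v)}"
    unfolding KS.C_def
    by (intro kspan_subset) (auto simp: cong_mod_refl KS.C_def[symmetric] intro!: kspan_base)
  then show ?thesis using assms(2) by blast
qed

section \<open>A k-linear projection of S onto J\<close>

text \<open>The canonical \<open>k\<close>-linear map from the free space on \<open>S\<close> to
  \<open>S\<close> that sends the symbol of \<open>x\<close> to \<open>x\<close>. It brings a
  projection constructed between function spaces down to the ring.\<close>

definition evaluate :: "('s \<Rightarrow> 'k) \<Rightarrow> 's" where
  "evaluate v = (\<Oplus>x\<in>{x. v x \<noteq> 0}. \<iota>S (v x) \<otimes> x)"

definition F :: "('s \<Rightarrow> 'k) set" where
  "F = {v \<in> fin_supp. {x. v x \<noteq> 0} \<subseteq> carrier S}"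

lemma \<iota>S_add: "\<iota>S (c + d) = \<iota>S c \<oplus> \<iota>S d" and \<iota>S_mult: "\<iota>S (c * d) = \<iota>S c \<otimes> \<iota>S d"
  and \<iota>S_1: "\<iota>S 1 = \<one>"
  using \<iota>S by (auto simp: ring_hom_def kring_def)

lemma \<iota>S_0: "\<iota>S 0 = \<zero>"
  using \<iota>S_add[of 0 0] KS.\<iota>_closed[of 0] by (metis S.add.r_cancel_one add_0)

lemma evaluate_finite:
  assumes "finite A" "{x. v x \<noteq> 0} \<subseteq> A" "A \<subseteq> carrier S"
  shows "evaluate v = (\<Oplus>x\<in>A. \<iota>S (v x) \<otimes> x)"
  unfolding evaluate_def
  by (rule S.add.finprod_mono_neutral_cong_left) (use assms in \<open>auto simp: \<iota>S_0\<close>)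

lemma subspace_F [simp]: "kv.subspace F"
proof (rule kv.subspaceI)
  have F: "kv.subspace (fin_supp :: ('s \<Rightarrow> 'k) set)" by simp
  show "0 \<in> F" using kv.subspace_0[OF F] by (simp add: F_def)
  show "u + v \<in> F" if "u \<in> F" "v \<in> F" for u v
    using kv.subspace_add[OF F, of u v] that unfolding F_def
    by (smt (verit) Collect_mono_iff add.left_neutral mem_Collect_eq plus_fun_apply subset_iff)
  show "ksc c v \<in> F" if "v \<in> F" for c v
    using kv.subspace_scale[OF F, of v c] that unfolding F_def by (auto simp: ksc_def)
qed

lemma dlt_F [simp]: "x \<in> carrier S \<Longrightarrow> dlt x \<in> F"
  unfolding F_def using dlt_fin_supp[of x] by (auto simp: dlt_def split: if_splits)

lemma evaluate_closed [simp]: "v \<in> F \<Longrightarrow> evaluate v \<in> carrier S"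
  unfolding evaluate_def F_def by (auto intro!: S.finsum_closed)

lemma evaluate_dlt: "x \<in> carrier S \<Longrightarrow> evaluate (dlt x) = x"
  by (subst evaluate_finite[of "{x}"]) (auto simp: dlt_def \<iota>S_1 split: if_splits)

lemma evaluate_add:
  assumes "u \<in> F" "v \<in> F"
  shows "evaluate (u + v) = evaluate u \<oplus> evaluate v"
proof -
  define A where "A = {x. u x \<noteq> 0} \<union> {x. v x \<noteq> 0}"
  have A: "finite A" "A \<subseteq> carrier S" "{x. u x \<noteq> 0} \<subseteq> A" "{x. v x \<noteq> 0} \<subseteq> A" "{x. (u + v) x \<noteq> 0} \<subseteq> A"
    using assms by (auto simp: A_def F_def fin_supp_def)
  have "(\<Oplus>x\<in>A. \<iota>S ((u + v) x) \<otimes> x) = (\<Oplus>x\<in>A. \<iota>S (u x) \<otimes> x \<oplus> \<iota>S (v x) \<otimes> x)"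
    by (rule S.add.finprod_cong') (use A in \<open>auto simp: \<iota>S_add S.l_distr\<close>)
  also have "\<dots> = (\<Oplus>x\<in>A. \<iota>S (u x) \<otimes> x) \<oplus> (\<Oplus>x\<in>A. \<iota>S (v x) \<otimes> x)"
    by (rule S.finsum_addf) (use A in auto)
  finally show ?thesis
    using evaluate_finite[OF A(1,3,2)] evaluate_finite[OF A(1,4,2)] evaluate_finite[OF A(1,5,2)] by (simp only:)
qed

lemma evaluate_scale:
  assumes "v \<in> F" shows "evaluate (ksc c v) = \<iota>S c \<otimes> evaluate v"
proof -
  define A where "A = {x. v x \<noteq> 0}"
  have A: "finite A" "A \<subseteq> carrier S" "{x. v x \<noteq> 0} \<subseteq> A" "{x. ksc c v x \<noteq> 0} \<subseteq> A"
    using assms by (auto simp: A_def F_def fin_supp_def ksc_def)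
  have "(\<Oplus>x\<in>A. \<iota>S (ksc c v x) \<otimes> x) = (\<Oplus>x\<in>A. \<iota>S c \<otimes> (\<iota>S (v x) \<otimes> x))"
    by (rule S.add.finprod_cong') (use A in \<open>auto simp: \<iota>S_mult S.m_assoc ksc_def\<close>)
  also have "\<dots> = \<iota>S c \<otimes> (\<Oplus>x\<in>A. \<iota>S (v x) \<otimes> x)"
    by (rule S.finsum_rdistr[symmetric]) (use A in auto)
  finally show ?thesis
    using evaluate_finite[OF A(1,3,2)] evaluate_finite[OF A(1,4,2)] by (simp only:)
qed

lemma evaluate_minus: "u \<in> F \<Longrightarrow> v \<in> F \<Longrightarrow> evaluate (u - v) = evaluate u \<ominus> evaluate v"
  using evaluate_add[of "u - v" v] kv.subspace_diff[OF subspace_F, of u v]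
  by (simp add: S.minus_eq S.a_assoc S.r_neg)

text \<open>Choose a projection of the function space \<open>'s \<Rightarrow> 'k\<close> onto the span of the symbols of \<open>J\<close>
  and of the linear relations of \<open>S\<close>, and evaluate its values in \<open>S\<close>.\<close>

lemma k_linear_projection:
  "\<exists>\<pi>. (\<forall>a\<in>carrier S. \<pi> a \<in> J) \<and> (\<forall>a\<in>J. \<pi> a = a) \<and>
     (\<forall>a\<in>carrier S. \<forall>b\<in>carrier S. \<pi> (a \<oplus> b) = \<pi> a \<oplus> \<pi> b) \<and>
     (\<forall>c. \<forall>a\<in>carrier S. \<pi> (\<iota>S c \<otimes> a) = \<iota>S c \<otimes> \<pi> a)"
proof -
  define N where "N = {dlt (a \<oplus> b) - (dlt a + dlt b :: 's \<Rightarrow> 'k) | a b. a \<in> carrier S \<and> b \<in> carrier S}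
     \<union> {dlt (\<iota>S c \<otimes> a) - ksc c (dlt a) | c a. a \<in> carrier S}"
  define U where "U = kspan (dlt ` J \<union> N)"
  have sub: "kv.subspace {v \<in> F. evaluate v \<in> J}"
  proof (rule kv.subspaceI)
    have "evaluate 0 = \<zero>" by (subst evaluate_finite[of "{}"]) (auto simp: zero_fun_def)
    then show "0 \<in> {v \<in> F. evaluate v \<in> J}" using kv.subspace_0[OF subspace_F] by simp
  qed (auto simp: evaluate_add evaluate_scale kv.subspace_add[OF subspace_F] kv.subspace_scale[OF subspace_F]
      intro: J.I_l_closed)
  have N: "n \<in> F \<and> evaluate n = \<zero>" if "n \<in> N" for n
    using that unfolding N_def
    by (auto simp: evaluate_add evaluate_scale evaluate_minus evaluate_dlt S.r_right_minus_eq S.minus_eq S.r_neg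
      kv.subspace_diff[OF subspace_F] kv.subspace_add[OF subspace_F] kv.subspace_scale[OF subspace_F])
  \<comment> \<open>Symbols of \<open>J\<close> evaluate into \<open>J\<close> and the relations
    \<open>N\<close> evaluate to zero, so evaluation after a projection onto \<open>U\<close> takes
    values in \<open>J\<close>.\<close>
  have U: "v \<in> F" "evaluate v \<in> J" if "v \<in> U" for v
  proof -
    have "U \<subseteq> {v \<in> F. evaluate v \<in> J}"
      unfolding U_def by (rule kspan_subset[OF _ sub]) (auto simp: evaluate_dlt N)
    then show "v \<in> F" "evaluate v \<in> J" using that by auto
  qed
  obtain P where P: "\<And>u v. P (u + v) = P u + P v" "\<And>c v. P (ksc c v) = ksc c (P v)"
    "\<And>v. P v \<in> U" "\<And>v. v \<in> U \<Longrightarrow> P v = v"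
    by (rule projection_onto_subspace[of U]) (auto simp: U_def)
  \<comment> \<open>\<open>N\<close> is part of \<open>U\<close> so that \<open>P\<close> fixes it:
    \<open>P u\<close> and \<open>P v\<close> then differ by \<open>u - v\<close> itself, which
    evaluates to zero. Hence the composite respects sums and scalars of \<open>S\<close>.\<close>
  have P_N: "evaluate (P u) = evaluate (P v)" if "u - v \<in> N" for u v
  proof -
    have "u - v \<in> U" unfolding U_def using that by (auto intro: kspan_base)
    then have "P (u - v) = u - v" by (rule P(4))
    moreover have "P ((u - v) + v) = P (u - v) + P v" by (rule P(1))
    ultimately have "P u = (u - v) + P v" by (simp only: diff_add_cancel)
    then show ?thesis using N[OF that] U(1)[OF P(3), of v] by (simp add: evaluate_add)
  qed
  show ?thesis
  proof (intro exI[of _ "\<lambda>a. evaluate (P (dlt a))"] conjI ballI allI)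
    fix a assume "a \<in> J"
    then have "dlt a \<in> U" unfolding U_def by (auto intro: kspan_base)
    then show "evaluate (P (dlt a)) = a" using \<open>a \<in> J\<close> by (simp add: P(4) evaluate_dlt)
  next
    fix a b assume ab: "a \<in> carrier S" "b \<in> carrier S"
    then have "evaluate (P (dlt (a \<oplus> b))) = evaluate (P (dlt a + dlt b))"
      by (intro P_N) (auto simp: N_def)
    then show "evaluate (P (dlt (a \<oplus> b))) = evaluate (P (dlt a)) \<oplus> evaluate (P (dlt b))"
      by (simp only: P(1) evaluate_add[OF U(1)[OF P(3)] U(1)[OF P(3)]])
  next
    fix c a assume "a \<in> carrier S"
    then have "evaluate (P (dlt (\<iota>S c \<otimes> a))) = evaluate (P (ksc c (dlt a)))"
      by (intro P_N) (auto simp: N_def)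
    then show "evaluate (P (dlt (\<iota>S c \<otimes> a))) = \<iota>S c \<otimes> evaluate (P (dlt a))"
      by (simp only: P(2) evaluate_scale[OF U(1)[OF P(3)]])
  qed (use U P in auto)
qed

end

section \<open>The first isomorphism\<close>

context excision_data
begin

abbreviation p1 :: "('s \<times> 's \<Rightarrow> 'k) \<Rightarrow> ('s \<times> ('s \<times> 's \<Rightarrow> 'k) set \<Rightarrow> 'k)" where
  "p1 \<equiv> phi1 S \<iota>S R f J"

lemma fs_linear_p1 [simp]: "fs_linear p1"
  by (simp add: phi1_def)

lemma p1_left: "a \<in> J \<Longrightarrow> p1 (dlt (a, b)) = br a (dlt (\<one>, b))"
  by (simp add: phi1_def br_def kd_def)

text \<open>\<open>phi1\<close> gives precedence to the left entry. When both entries lie in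
  \<open>J\<close> the two prescriptions do not conflict: \<open>a \<otimes> db\<close> and
  \<open>b \<otimes> da\<close> both vanish, because \<open>d\<close> vanishes on
  \<open>J\<close>.\<close>

lemma p1_right:
  assumes "a \<in> carrier S" "b \<in> J"
  shows "cong_mod T (p1 (dlt (a, b))) (- br b (dlt (\<one>, a)))"
proof (cases "a \<in> J")
  case True
  then have "p1 (dlt (a, b)) \<in> T" "br b (dlt (\<one>, a)) \<in> T"
    using assms by (auto simp: p1_left intro: br_J_right)
  then show ?thesis
    unfolding cong_mod_def by (intro kv.subspace_diff kv.subspace_neg subspace_T)
next
  case False
  then have "p1 (dlt (a, b)) = - br b (dlt (\<one>, a))"
    using assms by (simp only: phi1_def br_def kd_def lin_ext_dlt case_prod_conv if_True if_False)
  then show ?thesis by (simp only: cong_mod_refl[OF subspace_T])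
qed

lemma br_one_right: "x \<in> J \<Longrightarrow> b \<in> carrier S \<Longrightarrow> c \<in> carrier S \<Longrightarrow>
    cong_mod T (br (b \<otimes> x) (dlt (\<one>, c))) (br x (dlt (b, c)))"
  using br_mult[of x b "dlt (\<one>, c)"] by simp

text \<open>The Leibniz rule with its coefficients moved across the tensor sign, so that only
  differentials \<open>1 dc\<close> remain. In this form it matches the three terms of the boundary
  \<open>hb\<close>.\<close>

lemma br_leibniz:
  assumes "x \<in> J" "y \<in> carrier S" "z \<in> carrier S"
  shows "cong_mod T (br x (dlt (\<one>, y \<otimes> z))) (br (y \<otimes> x) (dlt (\<one>, z)) + br (z \<otimes> x) (dlt (\<one>, y)))"
proof -
  have "br x (dlt (\<one>, y \<otimes> z)) = br x (dlt (y, z) + dlt (z, y))"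
    using KS.K_cong(4)[of \<one> y z] assms by (intro br_cong) simp
  moreover have "cong_mod T (br x (dlt (y, z) + dlt (z, y))) (br x (dlt (y, z)) + br x (dlt (z, y)))"
    using assms by (intro br_add_right) auto
  moreover have "cong_mod T (br x (dlt (y, z)) + br x (dlt (z, y)))
      (br (y \<otimes> x) (dlt (\<one>, z)) + br (z \<otimes> x) (dlt (\<one>, y)))"
    using assms by (intro cong_mod_add[OF subspace_T] cong_mod_sym[OF subspace_T br_one_right])
  ultimately show ?thesis by (simp only:) (rule cong_mod_trans[OF subspace_T])
qed

lemma br_d_add:
  assumes "x \<in> J" "b \<in> carrier S" "c \<in> carrier S"
  shows "cong_mod T (br x (dlt (\<one>, b \<oplus> c))) (br x (dlt (\<one>, b)) + br x (dlt (\<one>, c)))"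
proof -
  have "br x (dlt (\<one>, b \<oplus> c)) = br x (dlt (\<one>, b) + dlt (\<one>, c))"
    using assms by (intro br_cong KS.K_cong) auto
  then show ?thesis using br_add_right[of x "dlt (\<one>, b)" "dlt (\<one>, c)"] assms by simp
qed

lemma d_\<iota>:
  assumes "b \<in> carrier S"
  shows "dlt (b, \<iota>S e) \<in> KS.K"
  using KS.K_cong(5)[OF assms, of "\<iota>R e"] \<iota>R f_\<iota> by (auto simp: ring_hom_def kring_def)

text \<open>\<open>kahler_rel\<close> has no relation for scalars under \<open>d\<close>. They come
  out by the Leibniz rule, whose other term contains \<open>d(\<iota>S e)\<close>; this is zero
  since \<open>\<iota>S e\<close> is the image under \<open>f\<close> of
  \<open>\<iota>R e\<close>.\<close>

lemma br_d_\<iota>: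
  assumes "x \<in> J" "b \<in> carrier S"
  shows "cong_mod T (br x (dlt (\<one>, \<iota>S e \<otimes> b))) (ksc e (br x (dlt (\<one>, b))))"
proof -
  have bx: "b \<otimes> x \<in> J" using assms by (intro J.I_l_closed)
  have "cong_mod T (br x (dlt (\<one>, \<iota>S e \<otimes> b))) (br (\<iota>S e \<otimes> x) (dlt (\<one>, b)) + br (b \<otimes> x) (dlt (\<one>, \<iota>S e)))"
    using assms by (intro br_leibniz) auto
  moreover have "cong_mod T (br (\<iota>S e \<otimes> x) (dlt (\<one>, b)) + br (b \<otimes> x) (dlt (\<one>, \<iota>S e)))
      (ksc e (br x (dlt (\<one>, b))) + 0)"
    using assms bx by (intro cong_mod_add[OF subspace_T] br_\<iota>)
      (auto simp: cong_mod_0[OF subspace_T] intro!: br_K d_\<iota>)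
  ultimately show ?thesis by (metis cong_mod_trans[OF subspace_T] add_0_right)
qed

abbreviation Z :: "('s \<times> 's \<Rightarrow> 'k) set" where "Z \<equiv> hh_cyc S J"

lemma subspace_Z [simp]: "kv.subspace Z"
  by (simp add: hh_cyc_def)

lemma dlt_Z: "x \<in> carrier S \<Longrightarrow> y \<in> carrier S \<Longrightarrow> x \<in> J \<or> y \<in> J \<Longrightarrow> dlt (x, y) \<in> Z"
  unfolding hh_cyc_def by (rule kspan_base) blast

lemma cong_mod_Z:
  assumes "kv.subspace N" "fs_linear \<phi>" "fs_linear \<psi>"
    "\<And>x y. x \<in> carrier S \<Longrightarrow> y \<in> carrier S \<Longrightarrow> x \<in> J \<or> y \<in> J \<Longrightarrow>
      cong_mod N (\<phi> (dlt (x, y))) (\<psi> (dlt (x, y)))" "v \<in> Z"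
  shows "cong_mod N (\<phi> v) (\<psi> v)"
  by (rule cong_mod_kspan[OF assms(1-3) _ _ assms(5)[unfolded hh_cyc_def]]) (use assms(4) in auto)

lemma fs_linear_Z:
  assumes "fs_linear \<phi>" "kv.subspace N"
    "\<And>x y. x \<in> carrier S \<Longrightarrow> y \<in> carrier S \<Longrightarrow> x \<in> J \<or> y \<in> J \<Longrightarrow> \<phi> (dlt (x, y)) \<in> N" "v \<in> Z"
  shows "\<phi> v \<in> N"
  by (rule fs_linear_kspan[OF assms(1,2) _ _ assms(4)[unfolded hh_cyc_def]]) (use assms(3) in auto)

lemma Z_fin_supp: "Z \<subseteq> fin_supp"
  unfolding hh_cyc_def by (rule kspan_subset) auto

text \<open>The symbols \<open>(a, b)\<close> with \<open>a\<close> or \<open>b\<close> in \<open>J\<close> may satisfy bilinear relations that pass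
  outside of \<open>J\<close>. A \<open>k\<close>-linear projection \<open>\<pi>\<close> onto \<open>J\<close> extends \<open>p1\<close> to the bilinear map
  \<open>(a, b) \<mapsto> \<pi> a \<otimes> db - \<pi> b \<otimes> da\<close> on all of \<open>S \<times> S\<close>, which kills them.\<close>

lemma p1_bilinear:
  assumes "v \<in> Z" "v \<in> kspan (ktens_rel S \<iota>S)"
  shows "p1 v \<in> T"
proof -
  obtain \<pi> where "\<forall>a\<in>carrier S. \<pi> a \<in> J" "\<forall>a\<in>J. \<pi> a = a"
    "\<forall>a\<in>carrier S. \<forall>b\<in>carrier S. \<pi> (a \<oplus> b) = \<pi> a \<oplus> \<pi> b"
    "\<forall>c. \<forall>a\<in>carrier S. \<pi> (\<iota>S c \<otimes> a) = \<iota>S c \<otimes> \<pi> a"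
    using k_linear_projection by (elim exE conjE)
  then have \<pi>: "\<And>a. a \<in> carrier S \<Longrightarrow> \<pi> a \<in> J" "\<And>a. a \<in> J \<Longrightarrow> \<pi> a = a"
    "\<And>a b. a \<in> carrier S \<Longrightarrow> b \<in> carrier S \<Longrightarrow> \<pi> (a \<oplus> b) = \<pi> a \<oplus> \<pi> b"
    "\<And>c a. a \<in> carrier S \<Longrightarrow> \<pi> (\<iota>S c \<otimes> a) = \<iota>S c \<otimes> \<pi> a"
    by simp_all
  define \<beta> where "\<beta> a b = br (\<pi> a) (dlt (\<one>, b))" for a b
  define \<Phi> where "\<Phi> = lin_ext (\<lambda>(a, b). \<beta> a b - \<beta> b a)"
  have \<Phi>: "fs_linear \<Phi>" and \<Phi>_dlt: "\<And>a b. \<Phi> (dlt (a, b)) = \<beta> a b - \<beta> b a"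
    unfolding \<Phi>_def by (rule fs_linear_lin_ext, simp only: lin_ext_dlt case_prod_conv)
  have \<beta>_add: "cong_mod T (\<beta> (a \<oplus> a') b) (\<beta> a b + \<beta> a' b)" "cong_mod T (\<beta> b (a \<oplus> a')) (\<beta> b a + \<beta> b a')"
    if "a \<in> carrier S" "a' \<in> carrier S" "b \<in> carrier S" for a a' b
    unfolding \<beta>_def using that by (auto simp: \<pi>(3) intro!: br_add_left br_d_add \<pi>(1))
  have \<beta>_\<iota>: "cong_mod T (\<beta> (\<iota>S e \<otimes> a) b) (ksc e (\<beta> a b))" "cong_mod T (\<beta> b (\<iota>S e \<otimes> a)) (ksc e (\<beta> b a))"
    if "a \<in> carrier S" "b \<in> carrier S" for a b e
    unfolding \<beta>_def using that by (auto simp: \<pi>(4) intro!: br_\<iota> br_d_\<iota> \<pi>(1))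
  \<comment> \<open>On a symbol of \<open>Z\<close> one of the two terms of \<open>\<Phi>\<close>
    contains the differential of an element of \<open>J\<close> and vanishes; the other is the value
    of \<open>p1\<close>, because \<open>\<pi>\<close> fixes \<open>J\<close>.\<close>
  have "cong_mod T (p1 v) (\<Phi> v)"
  proof (rule cong_mod_Z[OF subspace_T fs_linear_p1 \<Phi> _ assms(1)])
    fix x y assume xy: "x \<in> carrier S" "y \<in> carrier S" and J: "x \<in> J \<or> y \<in> J"
    from J show "cong_mod T (p1 (dlt (x, y))) (\<Phi> (dlt (x, y)))"
    proof
      assume x: "x \<in> J"
      have "br (\<pi> y) (dlt (\<one>, x)) \<in> T" using x xy by (intro br_J_right \<pi>) auto
      then have "cong_mod T (br x (dlt (\<one>, y)) - 0) (br x (dlt (\<one>, y)) - br (\<pi> y) (dlt (\<one>, x)))"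
        by (intro cong_mod_diff cong_mod_refl cong_mod_sym[OF subspace_T, of _ 0] subspace_T)
          (simp only: cong_mod_0[OF subspace_T])
      then show ?thesis using x by (simp only: p1_left \<Phi>_dlt \<beta>_def \<pi>(2) diff_0_right)
    next
      assume y: "y \<in> J"
      have "br (\<pi> x) (dlt (\<one>, y)) \<in> T" using y xy by (intro br_J_right \<pi>) auto
      then have "cong_mod T (0 - br y (dlt (\<one>, x))) (br (\<pi> x) (dlt (\<one>, y)) - br y (dlt (\<one>, x)))"
        by (intro cong_mod_diff cong_mod_refl cong_mod_sym[OF subspace_T, of _ 0] subspace_T)
          (simp only: cong_mod_0[OF subspace_T])
      then show ?thesis using cong_mod_trans[OF subspace_T p1_right[OF xy(1) y]] y
        by (simp only: \<Phi>_dlt \<beta>_def \<pi>(2) diff_0)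
    qed
  qed
  moreover have "\<Phi> v \<in> T"
  proof (rule fs_linear_kspan[OF \<Phi> subspace_T _ _ assms(2)])
    note fs = kv.subspace_diff[OF subspace_fin_supp] kv.subspace_scale[OF subspace_fin_supp] dlt_fin_supp
    show "ktens_rel S \<iota>S \<subseteq> fin_supp" unfolding ktens_rel_def by (auto intro!: fs)
    note lin = fs_linear_diff[OF \<Phi>] fs_linear_scale[OF \<Phi>] fs \<Phi>_dlt
    have eq: "x + y - (z + w) = (x - z) + (y - w)" for x y z w :: "'s \<times> ('s \<times> 's \<Rightarrow> 'k) set \<Rightarrow> 'k"
      by (rule add_diff_add)
    fix g assume "g \<in> ktens_rel S \<iota>S"
    then consider
      (a) a a' b where "g = dlt (a \<oplus> a', b) - dlt (a, b) - dlt (a', b)" "a \<in> carrier S" "a' \<in> carrier S" "b \<in> carrier S"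
    | (b) a b b' where "g = dlt (a, b \<oplus> b') - dlt (a, b) - dlt (a, b')" "a \<in> carrier S" "b \<in> carrier S" "b' \<in> carrier S"
    | (c) c a b where "g = dlt (\<iota>S c \<otimes> a, b) - ksc c (dlt (a, b))" "a \<in> carrier S" "b \<in> carrier S"
    | (d) c a b where "g = dlt (a, \<iota>S c \<otimes> b) - ksc c (dlt (a, b))" "a \<in> carrier S" "b \<in> carrier S"
      unfolding ktens_rel_def by blast
    then show "\<Phi> g \<in> T"
    proof cases
      case a
      have "cong_mod T (\<beta> (a \<oplus> a') b - \<beta> b (a \<oplus> a')) (\<beta> a b + \<beta> a' b - (\<beta> b a + \<beta> b a'))"
        using a by (intro cong_mod_diff[OF subspace_T] \<beta>_add)
      then show ?thesis unfolding eq a(1) by (simp only: cong_mod_diff2 lin)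
    next
      case b
      have "cong_mod T (\<beta> a (b \<oplus> b') - \<beta> (b \<oplus> b') a) (\<beta> a b + \<beta> a b' - (\<beta> b a + \<beta> b' a))"
        using b by (intro cong_mod_diff[OF subspace_T] \<beta>_add)
      then show ?thesis unfolding eq b(1) by (simp only: cong_mod_diff2 lin)
    next
      case c
      have "cong_mod T (\<beta> (\<iota>S c \<otimes> a) b - \<beta> b (\<iota>S c \<otimes> a)) (ksc c (\<beta> a b) - ksc c (\<beta> b a))"
        using c by (intro cong_mod_diff[OF subspace_T] \<beta>_\<iota>)
      then show ?thesis unfolding c(1) by (simp only: cong_mod_def lin kv.scale_right_diff_distrib)
    next
      case d
      have "cong_mod T (\<beta> a (\<iota>S c \<otimes> b) - \<beta> (\<iota>S c \<otimes> b) a) (ksc c (\<beta> a b) - ksc c (\<beta> b a))"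
        using d by (intro cong_mod_diff[OF subspace_T] \<beta>_\<iota>)
      then show ?thesis unfolding d(1) by (simp only: cong_mod_def lin kv.scale_right_diff_distrib)
    qed
  qed
  ultimately show ?thesis by (rule cong_mod_mem[OF subspace_T])
qed

text \<open>Whichever entry lies in \<open>J\<close>, the three terms are the Leibniz rule for the
  other two with that entry as coefficient: \<open>x \<otimes> d(yz)\<close>,
  \<open>y \<otimes> d(zx)\<close> or \<open>z \<otimes> d(xy)\<close>. The minus sign in
  \<open>p1_right\<close> makes the cyclic term fit.\<close>

lemma p1_hb:
  assumes "x \<in> carrier S" "y \<in> carrier S" "z \<in> carrier S" "x \<in> J \<or> y \<in> J \<or> z \<in> J"
  shows "p1 (hb S x y z) \<in> T"
proof -
  have p1: "p1 (hb S x y z) = p1 (dlt (x \<otimes> y, z)) - p1 (dlt (x, y \<otimes> z)) + p1 (dlt (z \<otimes> x, y))"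
    unfolding hb_def
    by (simp only: fs_linear_add[OF fs_linear_p1] fs_linear_diff[OF fs_linear_p1]
        kv.subspace_diff[OF subspace_fin_supp] dlt_fin_supp)
  note rules = cong_mod_add[OF subspace_T] cong_mod_diff[OF subspace_T] cong_mod_minus[OF subspace_T]
    cong_mod_refl[OF subspace_T] p1_right br_leibniz
  have "cong_mod T (p1 (hb S x y z)) 0"
    using assms(4)
  proof (elim disjE)
    assume x: "x \<in> J"
    then have "p1 (hb S x y z) = br (y \<otimes> x) (dlt (\<one>, z)) - br x (dlt (\<one>, y \<otimes> z)) + br (z \<otimes> x) (dlt (\<one>, y))"
      using p1 assms(1-3) J.I_l_closed[OF x assms(2)] J.I_l_closed[OF x assms(3)]
      by (simp only: p1_left S.m_comm[of x y])
    moreover have "cong_mod T (br (y \<otimes> x) (dlt (\<one>, z)) - br x (dlt (\<one>, y \<otimes> z)) + br (z \<otimes> x) (dlt (\<one>, y)))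
       (br (y \<otimes> x) (dlt (\<one>, z)) - (br (y \<otimes> x) (dlt (\<one>, z)) + br (z \<otimes> x) (dlt (\<one>, y))) + br (z \<otimes> x) (dlt (\<one>, y)))"
      using assms x by (intro rules)
    ultimately show ?thesis by simp
  next
    assume y: "y \<in> J"
    then have "p1 (hb S x y z) = br (x \<otimes> y) (dlt (\<one>, z)) - p1 (dlt (x, z \<otimes> y)) + p1 (dlt (z \<otimes> x, y))"
      using p1 assms(1-3) J.I_l_closed[OF y assms(1)] J.I_l_closed[OF y assms(3)]
      by (simp only: p1_left S.m_comm[of y z])
    moreover have "cong_mod T (br (x \<otimes> y) (dlt (\<one>, z)) - p1 (dlt (x, z \<otimes> y)) + p1 (dlt (z \<otimes> x, y)))
       (br (x \<otimes> y) (dlt (\<one>, z)) - (- br (z \<otimes> y) (dlt (\<one>, x))) + (- br y (dlt (\<one>, z \<otimes> x))))"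
      using assms y by (intro rules J.I_l_closed) auto
    moreover have "cong_mod T (br (x \<otimes> y) (dlt (\<one>, z)) - (- br (z \<otimes> y) (dlt (\<one>, x))) + (- br y (dlt (\<one>, z \<otimes> x))))
       (br (x \<otimes> y) (dlt (\<one>, z)) - (- br (z \<otimes> y) (dlt (\<one>, x)))
         + (- (br (z \<otimes> y) (dlt (\<one>, x)) + br (x \<otimes> y) (dlt (\<one>, z)))))"
      using assms y by (intro rules)
    ultimately have "cong_mod T (p1 (hb S x y z)) (br (x \<otimes> y) (dlt (\<one>, z)) - (- br (z \<otimes> y) (dlt (\<one>, x))) + (- (br (z \<otimes> y) (dlt (\<one>, x)) + br (x \<otimes> y) (dlt (\<one>, z)))))"
      by (simp only:) (rule cong_mod_trans[OF subspace_T])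
    then show ?thesis by simp
  next
    assume z: "z \<in> J"
    then have "p1 (hb S x y z) = p1 (dlt (x \<otimes> y, z)) - p1 (dlt (x, y \<otimes> z)) + br (x \<otimes> z) (dlt (\<one>, y))"
      using p1 assms(1-3) J.I_l_closed[OF z assms(1)] J.I_l_closed[OF z assms(2)]
      by (simp only: p1_left S.m_comm[of z x])
    moreover have "cong_mod T (p1 (dlt (x \<otimes> y, z)) - p1 (dlt (x, y \<otimes> z)) + br (x \<otimes> z) (dlt (\<one>, y)))
       (- br z (dlt (\<one>, x \<otimes> y)) - (- br (y \<otimes> z) (dlt (\<one>, x))) + br (x \<otimes> z) (dlt (\<one>, y)))"
      using assms z by (intro rules J.I_l_closed) auto
    moreover have "cong_mod T (- br z (dlt (\<one>, x \<otimes> y)) - (- br (y \<otimes> z) (dlt (\<one>, x))) + br (x \<otimes> z) (dlt (\<one>, y)))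
       (- (br (x \<otimes> z) (dlt (\<one>, y)) + br (y \<otimes> z) (dlt (\<one>, x))) - (- br (y \<otimes> z) (dlt (\<one>, x))) + br (x \<otimes> z) (dlt (\<one>, y)))"
      using assms z by (intro rules)
    ultimately have "cong_mod T (p1 (hb S x y z)) (- (br (x \<otimes> z) (dlt (\<one>, y)) + br (y \<otimes> z) (dlt (\<one>, x))) - (- br (y \<otimes> z) (dlt (\<one>, x))) + br (x \<otimes> z) (dlt (\<one>, y)))"
      by (simp only:) (rule cong_mod_trans[OF subspace_T])
    then show ?thesis by simp
  qed
  then show ?thesis by (simp only: cong_mod_0[OF subspace_T])
qed

end

section \<open>Relations in the cokernel of the map on first Hochschild homology\<close>

lemma subspace_hh_bd [simp]: "kv.subspace (hh_bd T \<iota> I)"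
  by (simp add: hh_bd_def)

context excision_data
begin

abbreviation bot :: "('s \<times> 's \<Rightarrow> 'k) set" where "bot \<equiv> hh0_bot R \<iota>R S \<iota>S f I J"

lemma subspace_bot [simp]: "kv.subspace bot"
  by (simp add: hh0_bot_def)

lemma bot_bilinear:
  assumes "v \<in> Z" "v \<in> ktens_rel S \<iota>S"
  shows "v \<in> bot"
proof -
  have "v \<in> hh_bd S \<iota>S J"
    unfolding hh_bd_def using assms by (intro kspan_base) (blast intro: kspan_base)
  then show ?thesis unfolding hh0_bot_def by (blast intro: kspan_base)
qed

lemma bot_hb:
  assumes "x \<in> carrier S" "y \<in> carrier S" "z \<in> carrier S" "x \<in> J \<or> y \<in> J \<or> z \<in> J"
  shows "cong_mod bot (dlt (x, y \<otimes> z)) (dlt (x \<otimes> y, z) + dlt (z \<otimes> x, y))"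
proof -
  have "(hb S x y z :: _ \<Rightarrow> 'k) \<in> hh_bd S \<iota>S J"
    unfolding hh_bd_def using assms by (intro kspan_base) blast
  then have "hb S x y z \<in> bot" unfolding hh0_bot_def by (blast intro: kspan_base)
  then have "- hb S x y z \<in> bot" by (rule kv.subspace_neg[OF subspace_bot])
  moreover have "- hb S x y z = (dlt (x, y \<otimes> z) - (dlt (x \<otimes> y, z) + dlt (z \<otimes> x, y)) :: _ \<Rightarrow> 'k)"
    by (simp add: hb_def)
  ultimately show ?thesis by (simp only: cong_mod_def)
qed

lemma bot_f:
  assumes "x \<in> carrier R" "y \<in> carrier R" "x \<in> I \<or> y \<in> I"
  shows "dlt (f x, f y) \<in> bot"
proof -
  have "tens_map f (dlt (x, y)) \<in> bot" unfolding hh0_bot_def hh_cyc_def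
    using assms by (intro kspan_base UnI2 imageI) blast
  then show ?thesis by (simp add: tens_map_def)
qed

text \<open>A bilinearity relation is divided out only if it lies in \<open>Z\<close>. With the left
  entry in \<open>J\<close> every symbol that occurs is in \<open>Z\<close>, so these instances are
  available.\<close>

lemma bot_cong:
  assumes "x \<in> J"
  shows "x' \<in> J \<Longrightarrow> c \<in> carrier S \<Longrightarrow> cong_mod bot (dlt (x \<oplus> x', c)) (dlt (x, c) + dlt (x', c))"
    and "c \<in> carrier S \<Longrightarrow> c' \<in> carrier S \<Longrightarrow> cong_mod bot (dlt (x, c \<oplus> c')) (dlt (x, c) + dlt (x, c'))"
    and "c \<in> carrier S \<Longrightarrow> cong_mod bot (dlt (\<iota>S e \<otimes> x, c)) (ksc e (dlt (x, c)))"
proof -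
  note Z = kv.subspace_diff[OF subspace_Z] kv.subspace_scale[OF subspace_Z] dlt_Z J_carrier
  show "cong_mod bot (dlt (x \<oplus> x', c)) (dlt (x, c) + dlt (x', c))" if "x' \<in> J" "c \<in> carrier S"
    unfolding cong_mod_diff2 using that assms
    by (intro bot_bilinear) (simp add: Z J.a_closed, unfold ktens_rel_def, blast intro: J_carrier)
  show "cong_mod bot (dlt (x, c \<oplus> c')) (dlt (x, c) + dlt (x, c'))" if "c \<in> carrier S" "c' \<in> carrier S"
    unfolding cong_mod_diff2 using that assms
    by (intro bot_bilinear) (simp add: Z, unfold ktens_rel_def, blast intro: J_carrier)
  show "cong_mod bot (dlt (\<iota>S e \<otimes> x, c)) (ksc e (dlt (x, c)))" if "c \<in> carrier S"
    unfolding cong_mod_def using that assms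
    by (intro bot_bilinear) (simp add: Z J.I_l_closed, unfold ktens_rel_def, blast intro: J_carrier)
qed

text \<open>Makes \<open>b dc \<mapsto> xb \<otimes> c\<close> well defined on differentials. Linear
  relations become bilinearity in the cokernel, the Leibniz rule becomes the boundary of
  \<open>xb \<otimes> c \<otimes> c'\<close>, and for \<open>b d(f a)\<close> both
  \<open>xb\<close>, an element of \<open>f(I)\<close>, and \<open>f a\<close> come from
  \<open>R\<close>.\<close>

lemma mu_K_bot:
  assumes x: "x \<in> J" and v: "v \<in> KS.K"
  shows "KS.mu x v \<in> bot"
proof (rule KS.K_map[OF KS.fs_linear_mu subspace_bot _ _ _ _ _ v])
  fix b b' c assume b: "b \<in> carrier S" "b' \<in> carrier S" "c \<in> carrier S"
  have xb: "x \<otimes> b \<in> J" "x \<otimes> b' \<in> J" using x b by (auto intro: J.I_r_closed)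
  show "cong_mod bot (KS.mu x (dlt (b \<oplus> b', c))) (KS.mu x (dlt (b, c)) + KS.mu x (dlt (b', c)))"
    using bot_cong(1)[OF xb b(3)] x b by (simp only: KS.mu_dlt S.r_distr J_carrier)
next
  fix e b c assume b: "b \<in> carrier S" "c \<in> carrier S"
  have xb: "x \<otimes> b \<in> J" using x b by (auto intro: J.I_r_closed)
  show "cong_mod bot (KS.mu x (dlt (\<iota>S e \<otimes> b, c))) (ksc e (KS.mu x (dlt (b, c))))"
    using bot_cong(3)[OF xb b(2)] x b by (simp only: KS.mu_dlt S.m_lcomm KS.\<iota>_closed J_carrier)
next
  fix b c c' assume b: "b \<in> carrier S" "c \<in> carrier S" "c' \<in> carrier S"
  have xb: "x \<otimes> b \<in> J" using x b by (auto intro: J.I_r_closed)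
  show "cong_mod bot (KS.mu x (dlt (b, c \<oplus> c'))) (KS.mu x (dlt (b, c)) + KS.mu x (dlt (b, c')))"
    using bot_cong(2)[OF xb b(2,3)] by (simp only: KS.mu_dlt)
  have "c' \<otimes> (x \<otimes> b) = x \<otimes> (b \<otimes> c')" "(x \<otimes> b) \<otimes> c = x \<otimes> (b \<otimes> c)"
    using x b by (simp_all add: S.m_ac)
  then show "cong_mod bot (KS.mu x (dlt (b, c \<otimes> c'))) (KS.mu x (dlt (b \<otimes> c, c')) + KS.mu x (dlt (b \<otimes> c', c)))"
    using bot_hb[OF J_carrier[OF xb] b(2,3) disjI1[OF xb]] by (simp only: KS.mu_dlt)
next
  fix b a assume b: "b \<in> carrier S" and a: "a \<in> carrier R"
  have "x \<otimes> b \<in> J" using x b by (auto intro: J.I_r_closed)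
  then obtain i where "i \<in> I" "x \<otimes> b = f i" by (auto simp: J_eq)
  then show "KS.mu x (dlt (b, f a)) \<in> bot" using a I_carrier by (auto intro: bot_f)
qed

lemma mu_cong_bot:
  assumes "x \<in> J" "cong_mod KS.K u v" "u \<in> KS.C" "v \<in> KS.C"
  shows "cong_mod bot (KS.mu x u) (KS.mu x v)"
proof -
  have "KS.mu x (u - v) = KS.mu x u - KS.mu x v"
    using assms KS.C_fin_supp by (intro fs_linear_diff[OF KS.fs_linear_mu]) auto
  then show ?thesis using mu_K_bot[OF assms(1), of "u - v"] assms(2) by (simp only: cong_mod_def)
qed

section \<open>The inverse of the first map\<close>

definition psi1 :: "('s \<times> ('s \<times> 's \<Rightarrow> 'k) set \<Rightarrow> 'k) \<Rightarrow> ('s \<times> 's \<Rightarrow> 'k)" where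
  "psi1 = lin_ext (\<lambda>(x, \<omega>). if \<omega> \<in> \<Omega> then KS.mu x (rp \<omega>) else 0)"

lemma fs_linear_psi1 [simp]: "fs_linear psi1"
  by (simp add: psi1_def)

lemma psi1_br_eq: "v \<in> KS.C \<Longrightarrow> psi1 (br x v) = KS.mu x (rp (cls KS.K v))"
  by (simp only: psi1_def br_def lin_ext_dlt case_prod_conv KS.cls_in_kahler if_True)

text \<open>Frees \<open>psi1\<close> from the choice made by \<open>rp\<close>: another
  representative changes the value only within \<open>bot\<close>.\<close>

lemma psi1_br: "x \<in> J \<Longrightarrow> v \<in> KS.C \<Longrightarrow> cong_mod bot (psi1 (br x v)) (KS.mu x v)"
  unfolding psi1_br_eq
  by (intro mu_cong_bot rp_cls_cong KS.rp_cls_C KS.subspace_K)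

lemma psi1_fin_supp: "psi1 w \<in> fin_supp"
proof -
  have "KS.mu x v \<in> fin_supp" for x v
    unfolding KS.mu_def by (rule lin_ext_fin_supp) (simp add: split_beta)
  then show ?thesis
    unfolding psi1_def by (intro lin_ext_fin_supp) (simp add: split_beta)
qed

lemma p1_fin_supp: "p1 v \<in> fin_supp"
  unfolding phi1_def by (rule lin_ext_fin_supp) (simp only: split_beta split: if_split, simp)

text \<open>After \<open>psi1_br\<close> has traded chosen representatives for convenient ones, each
  relation of the balanced tensor product is an identity about \<open>mu\<close>, which can be
  tested on the symbols \<open>b dc\<close> since both sides are linear.\<close>

lemma psi1_T:
  assumes "w \<in> T"
  shows "psi1 w \<in> bot"
proof (rule tens_rel_map[OF fs_linear_psi1 subspace_bot _ _ _ _ assms[unfolded IOm_rel_def]])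
  note trans = cong_mod_trans[OF subspace_bot] and sym = cong_mod_sym[OF subspace_bot]
    and add = cong_mod_add[OF subspace_bot]
  fix x n assume x: "x \<in> J" and n: "n \<in> \<Omega>"
  from n obtain v where v: "v \<in> KS.C" "n = cls KS.K v" by (rule KS.kahler_cases)
  { fix x' assume x': "x' \<in> J"
    have "cong_mod bot (psi1 (br (x \<oplus> x') v)) (KS.mu (x \<oplus> x') v)"
      using x x' v by (intro psi1_br J.a_closed)
    moreover have "cong_mod bot (KS.mu (x \<oplus> x') v) (KS.mu x v + KS.mu x' v)"
    proof (rule KS.cong_mod_C[OF subspace_bot KS.fs_linear_mu fs_linear_plus[OF KS.fs_linear_mu KS.fs_linear_mu] _ v(1)])
      fix b c assume b: "b \<in> carrier S" "c \<in> carrier S"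
      show "cong_mod bot (KS.mu (x \<oplus> x') (dlt (b, c))) (KS.mu x (dlt (b, c)) + KS.mu x' (dlt (b, c)))"
        using bot_cong(1)[of "x \<otimes> b" "x' \<otimes> b" c] x x' b J.I_r_closed[OF x b(1)] J.I_r_closed[OF x' b(1)]
        by (simp only: KS.mu_dlt S.l_distr J_carrier)
    qed
    moreover have "cong_mod bot (KS.mu x v + KS.mu x' v) (psi1 (br x v) + psi1 (br x' v))"
      using x x' v by (intro add sym[OF psi1_br])
    ultimately have "cong_mod bot (psi1 (br (x \<oplus> x') v)) (psi1 (br x v) + psi1 (br x' v))"
      by (blast intro: trans)
    then show "cong_mod bot (psi1 (dlt (x \<oplus> x', n))) (psi1 (dlt (x, n)) + psi1 (dlt (x', n)))"
      by (simp only: br_def v) }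
  { fix n' assume "n' \<in> \<Omega>"
    then obtain v' where v': "v' \<in> KS.C" "n' = cls KS.K v'" by (rule KS.kahler_cases)
    have "cong_mod bot (psi1 (br x (v + v'))) (KS.mu x (v + v'))"
      using x v v' by (intro psi1_br kv.subspace_add[OF KS.subspace_C])
    moreover have "KS.mu x (v + v') = KS.mu x v + KS.mu x v'"
      using v v' KS.C_fin_supp by (intro fs_linear_add[OF KS.fs_linear_mu]) auto
    moreover have "cong_mod bot (KS.mu x v + KS.mu x v') (psi1 (br x v) + psi1 (br x v'))"
      using x v v' by (intro add sym[OF psi1_br])
    ultimately have "cong_mod bot (psi1 (br x (v + v'))) (psi1 (br x v) + psi1 (br x v'))"
      by (simp only:) (rule trans)
    then show "cong_mod bot (psi1 (dlt (x, kahler_add S \<iota>S R f n n'))) (psi1 (dlt (x, n)) + psi1 (dlt (x, n')))"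
      by (simp only: br_def v v' KS.kahler_add_cls) }
  { fix s assume s: "s \<in> carrier S"
    have "cong_mod bot (psi1 (br (s \<otimes> x) v)) (KS.mu (s \<otimes> x) v)"
      using x s v by (intro psi1_br J.I_l_closed)
    moreover have "cong_mod bot (KS.mu (s \<otimes> x) v) (KS.mu x (KS.mu s v))"
    proof (rule KS.cong_mod_C[OF subspace_bot KS.fs_linear_mu _ _ v(1)])
      show "fs_linear (\<lambda>v. KS.mu x (KS.mu s v))"
        unfolding KS.mu_def[of s] by (rule fs_linear_comp_lin_ext) auto
      fix b c assume b: "b \<in> carrier S" "c \<in> carrier S"
      have "(s \<otimes> x) \<otimes> b = x \<otimes> (s \<otimes> b)" using b s x by (simp add: S.m_ac)
      then show "cong_mod bot (KS.mu (s \<otimes> x) (dlt (b, c))) (KS.mu x (KS.mu s (dlt (b, c))))"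
        by (simp only: KS.mu_dlt cong_mod_refl[OF subspace_bot])
    qed
    moreover have "cong_mod bot (KS.mu x (KS.mu s v)) (psi1 (br x (KS.mu s v)))"
      using x s v by (intro sym[OF psi1_br] KS.mu_C)
    ultimately have "cong_mod bot (psi1 (br (s \<otimes> x) v)) (psi1 (br x (KS.mu s v)))"
      by (blast intro: trans)
    then show "cong_mod bot (psi1 (dlt (s \<otimes> x, n))) (psi1 (dlt (x, kahler_act S \<iota>S R f s n)))"
      using s v by (simp only: br_def KS.kahler_act_cls) }
  fix e
  have "cong_mod bot (psi1 (br (\<iota>S e \<otimes> x) v)) (KS.mu (\<iota>S e \<otimes> x) v)"
    using x v by (intro psi1_br J.I_l_closed KS.\<iota>_closed)
  moreover have "cong_mod bot (KS.mu (\<iota>S e \<otimes> x) v) (ksc e (KS.mu x v))"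
  proof (rule KS.cong_mod_C[OF subspace_bot KS.fs_linear_mu _ _ v(1)])
    show "fs_linear (\<lambda>v. ksc e (KS.mu x v))"
      unfolding KS.mu_def[of x] by (rule fs_linear_comp_lin_ext[OF fs_linear_ksc]) auto
    fix b c assume b: "b \<in> carrier S" "c \<in> carrier S"
    show "cong_mod bot (KS.mu (\<iota>S e \<otimes> x) (dlt (b, c))) (ksc e (KS.mu x (dlt (b, c))))"
      using bot_cong(3)[of "x \<otimes> b" c] x b J.I_r_closed[OF x b(1)]
      by (simp only: KS.mu_dlt S.m_assoc J_carrier KS.\<iota>_closed)
  qed
  moreover have "cong_mod bot (ksc e (KS.mu x v)) (ksc e (psi1 (br x v)))"
    using x v by (intro cong_mod_scale[OF subspace_bot] sym[OF psi1_br])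
  ultimately have "cong_mod bot (psi1 (br (\<iota>S e \<otimes> x) v)) (ksc e (psi1 (br x v)))"
    by (blast intro: trans)
  then show "cong_mod bot (psi1 (dlt (\<iota>S e \<otimes> x, n))) (ksc e (psi1 (dlt (x, n))))"
    by (simp only: br_def v)
qed

lemma IOm_top_linear:
  assumes "fs_linear \<phi>" "kv.subspace N" "\<And>x v. x \<in> J \<Longrightarrow> v \<in> KS.C \<Longrightarrow> \<phi> (br x v) \<in> N"
    "w \<in> IOm_top S \<iota>S R f J"
  shows "\<phi> w \<in> N"
  by (rule fs_linear_kspan[OF assms(1,2) _ _ assms(4)[unfolded IOm_top_def tens_top_def]])
    (use assms(3) in \<open>auto simp: br_def elim!: KS.kahler_cases\<close>)

lemma IOm_top_fin_supp: "IOm_top S \<iota>S R f J \<subseteq> fin_supp"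
  unfolding IOm_top_def tens_top_def by (rule kspan_subset) auto

lemma br_IOm_top: "x \<in> J \<Longrightarrow> v \<in> KS.C \<Longrightarrow> br x v \<in> IOm_top S \<iota>S R f J"
  unfolding IOm_top_def tens_top_def br_def by (rule kspan_base) (blast intro: KS.cls_in_kahler)

lemma subspace_IOm_top [simp]: "kv.subspace (IOm_top S \<iota>S R f J)"
  by (simp add: IOm_top_def tens_top_def)

text \<open>\<open>bot\<close> has three sources: boundaries, bilinearity relations inside
  \<open>Z\<close>, and tensors from \<open>R\<close>. The last are killed because whichever entry
  is in \<open>J\<close>, the other one is some \<open>f a\<close> and appears under
  \<open>d\<close>.\<close>

lemma p1_bot:
  assumes "v \<in> bot" shows "p1 v \<in> T"
proof -
  have hb: "p1 v \<in> T" if "v \<in> hh_bd S \<iota>S J" for v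
  proof (rule fs_linear_kspan[OF fs_linear_p1 subspace_T _ _ that[unfolded hh_bd_def]])
    show "{hb S x y z |x y z. x \<in> carrier S \<and> y \<in> carrier S \<and> z \<in> carrier S \<and> (x \<in> J \<or> y \<in> J \<or> z \<in> J)} \<union>
      (Z \<inter> kspan (ktens_rel S \<iota>S)) \<subseteq> fin_supp"
      using Z_fin_supp unfolding hb_def
      by (auto intro!: kv.subspace_add[OF subspace_fin_supp] kv.subspace_diff[OF subspace_fin_supp])
  qed (use p1_hb p1_bilinear in blast)
  have fin: "hh_bd S \<iota>S J \<subseteq> fin_supp"
    unfolding hh_bd_def using Z_fin_supp unfolding hb_def
    by (intro kspan_subset)
      (auto intro!: kv.subspace_add[OF subspace_fin_supp] kv.subspace_diff[OF subspace_fin_supp])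
  have tens: "p1 (tens_map f v) \<in> T \<and> tens_map f v \<in> fin_supp" if "v \<in> hh_cyc R I" for v :: "_ \<Rightarrow> 'k"
  proof
    have "fs_linear (\<lambda>v. p1 (tens_map f v))"
      unfolding tens_map_def by (rule fs_linear_comp_lin_ext) auto
    then show "p1 (tens_map f v) \<in> T"
    proof (rule fs_linear_kspan[OF _ subspace_T _ _ that[unfolded hh_cyc_def]])
      fix g :: "'r \<times> 'r \<Rightarrow> 'k" assume "g \<in> {dlt (x, y) |x y. x \<in> carrier R \<and> y \<in> carrier R \<and> (x \<in> I \<or> y \<in> I)}"
      then obtain x y where xy: "x \<in> carrier R" "y \<in> carrier R" "x \<in> I \<or> y \<in> I" and g: "g = dlt (x, y)"
        by blast
      have *: "dlt (\<one>, f a) \<in> KS.K" if "a \<in> carrier R" for a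
        using that by (intro KS.K_cong(5)) auto
      have "p1 (dlt (f x, f y)) \<in> T"
        using xy(3)
      proof
        assume "x \<in> I"
        then have "f x \<in> J" by (simp add: J_eq)
        then show ?thesis using *[OF xy(2)] by (simp only: p1_left br_K)
      next
        assume "y \<in> I"
        then have "f y \<in> J" by (simp add: J_eq)
        moreover from this have "- br (f y) (dlt (\<one>, f x)) \<in> T"
          using *[OF xy(1)] by (intro kv.subspace_neg[OF subspace_T] br_K)
        ultimately show ?thesis
          using cong_mod_mem[OF subspace_T p1_right] f_closed[OF xy(1)] by blast
      qed
      then show "p1 (tens_map f g) \<in> T" by (simp add: g tens_map_def)
    qed auto
    show "tens_map f v \<in> fin_supp"
      unfolding tens_map_def by (rule lin_ext_fin_supp) (simp add: split_beta)
  qed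
  show ?thesis
  proof (rule fs_linear_kspan[OF fs_linear_p1 subspace_T _ _ assms[unfolded hh0_bot_def]])
    show "hh_bd S \<iota>S J \<union> tens_map f ` hh_cyc R I \<subseteq> fin_supp"
      using fin tens by blast
    show "p1 g \<in> T" if "g \<in> hh_bd S \<iota>S J \<union> tens_map f ` hh_cyc R I" for g
      using that hb tens by blast
  qed
qed

text \<open>For \<open>a\<close> in \<open>J\<close> the round trip returns
  \<open>a \<otimes> b\<close> directly. For \<open>b\<close> in \<open>J\<close> it returns
  \<open>- b \<otimes> a\<close>, and the antisymmetry of the cokernel is needed to identify this
  with \<open>a \<otimes> b\<close>.\<close>

lemma psi1_p1:
  assumes "v \<in> Z"
  shows "cong_mod bot (psi1 (p1 v)) v"
proof (rule cong_mod_Z[OF subspace_bot _ fs_linear_id _ assms])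
  note trans = cong_mod_trans[OF subspace_bot] and sym = cong_mod_sym[OF subspace_bot]
  show "fs_linear (\<lambda>v. psi1 (p1 v))"
    by (rule fs_linear_comp[OF fs_linear_p1 fs_linear_psi1 p1_fin_supp])
  fix a b assume ab: "a \<in> carrier S" "b \<in> carrier S" "a \<in> J \<or> b \<in> J"
  have psi: "cong_mod bot (psi1 (br x (dlt (\<one>, c)))) (dlt (x, c))" if "x \<in> J" "c \<in> carrier S" for x c
    using psi1_br[OF that(1), of "dlt (\<one>, c)"] that by simp
  show "cong_mod bot (psi1 (p1 (dlt (a, b)))) (dlt (a, b))"
  proof (cases "a \<in> J")
    case True
    then show ?thesis using psi ab by (simp only: p1_left)
  next
    case False
    then have b: "b \<in> J" using ab by simp
    have "p1 (dlt (a, b)) = - br b (dlt (\<one>, a))"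
      using False b by (simp only: phi1_def br_def kd_def lin_ext_dlt case_prod_conv if_True if_False)
    then have "psi1 (p1 (dlt (a, b))) = - psi1 (br b (dlt (\<one>, a)))"
      by (simp only: fs_linear_neg[OF fs_linear_psi1] br_def dlt_fin_supp)
    moreover have "cong_mod bot (- psi1 (br b (dlt (\<one>, a)))) (- dlt (b, a))"
      using b ab by (intro cong_mod_minus[OF subspace_bot] psi)
    moreover have "cong_mod bot (- dlt (b, a)) (dlt (a, b))"
    proof -
      have "cong_mod bot (dlt (\<one>, a \<otimes> b)) (dlt (\<one> \<otimes> a, b) + dlt (b \<otimes> \<one>, a))"
        using ab b by (intro bot_hb) auto
      moreover have "dlt (\<one>, a \<otimes> b) \<in> bot"
      proof -
        have "a \<otimes> b \<in> J" using ab b by (intro J.I_l_closed)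
        then obtain i where i: "i \<in> I" "a \<otimes> b = f i" by (auto simp: J_eq)
        have "\<one>\<^bsub>R\<^esub> \<in> carrier R" using R cring.axioms(1) ring.ring_simprules(6) by blast
        then have "dlt (f \<one>\<^bsub>R\<^esub>, f i) \<in> bot" using i I_carrier by (intro bot_f) auto
        then show ?thesis using i ring_hom_one[OF f] by simp
      qed
      ultimately have "dlt (\<one> \<otimes> a, b) + dlt (b \<otimes> \<one>, a) \<in> bot"
        by (blast intro: cong_mod_mem[OF subspace_bot] sym)
      then have "- (dlt (a, b) + dlt (b, a)) \<in> bot"
        using ab by (intro kv.subspace_neg[OF subspace_bot]) simp
      moreover have "- dlt (b, a) - dlt (a, b) = - (dlt (a, b) + dlt (b, a) :: _ \<Rightarrow> 'k)"
        by (simp add: algebra_simps)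
      ultimately show ?thesis by (simp only: cong_mod_def)
    qed
    ultimately show ?thesis by (simp only:) (rule trans)
  qed
qed

text \<open>On a symbol, \<open>xb \<otimes> dc\<close> is \<open>x \<otimes> b dc\<close>;
  \<open>br_expand\<close> reassembles these terms into the tensor with the whole
  differential.\<close>

lemma p1_psi1:
  assumes "w \<in> IOm_top S \<iota>S R f J"
  shows "cong_mod T (p1 (psi1 w)) w"
proof -
  have lin: "fs_linear (\<lambda>w. p1 (psi1 w) - w)"
  by (intro fs_linear_minus fs_linear_id fs_linear_comp[OF fs_linear_psi1 fs_linear_p1] psi1_fin_supp)
  have "p1 (psi1 w) - w \<in> T"
  proof (rule IOm_top_linear[OF lin subspace_T _ assms])
    fix x v assume x: "x \<in> J" and v: "v \<in> KS.C"
    \<comment> \<open>The representative that \<open>psi1\<close> actually uses; \<open>br\<close>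
      cannot tell it from \<open>v\<close>.\<close>
    define u where "u = rp (cls KS.K v)"
    have u: "u \<in> KS.C" "br x u = br x v"
      unfolding u_def by (rule KS.rp_cls_C[OF v], rule br_cong[OF rp_cls_cong[OF KS.subspace_K]])
    have "cong_mod T (p1 (KS.mu x u)) (lin_ext (\<lambda>p. br x (dlt p)) u)"
    proof (rule KS.cong_mod_C[OF subspace_T _ fs_linear_lin_ext _ u(1)])
      show "fs_linear (\<lambda>v. p1 (KS.mu x v))"
        unfolding KS.mu_def by (rule fs_linear_comp_lin_ext) auto
      fix b c assume b: "b \<in> carrier S" "c \<in> carrier S"
      have "b \<otimes> x \<in> J" using b x by (intro J.I_l_closed)
      then show "cong_mod T (p1 (KS.mu x (dlt (b, c)))) (lin_ext (\<lambda>p. br x (dlt p)) (dlt (b, c)))"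
        using br_one_right[OF x b] S.m_comm[of x b] x b by (simp only: KS.mu_dlt p1_left lin_ext_dlt J_carrier)
    qed
    then have "cong_mod T (p1 (KS.mu x u)) (br x u)"
      using cong_mod_trans[OF subspace_T _ br_expand[OF x u(1)]] by blast
    moreover have "psi1 (br x v) = KS.mu x u"
      using v by (simp add: psi1_br_eq u_def)
    ultimately show "p1 (psi1 (br x v)) - br x v \<in> T" by (simp only: u(2) cong_mod_def)
  qed
  then show ?thesis by (simp only: cong_mod_def)
qed

lemma induces_iso_p1: "induces_iso p1 (hh0_top S J) bot (IOm_top S \<iota>S R f J) T"
  unfolding hh0_top_def
proof (rule induces_iso_by_inverse[where \<psi> = psi1, OF fs_linear_p1 subspace_bot subspace_T Z_fin_supp IOm_top_fin_supp])
  show "p1 v \<in> IOm_top S \<iota>S R f J" if "v \<in> Z" for v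
  proof (rule fs_linear_Z[OF fs_linear_p1 subspace_IOm_top _ that])
    fix x y assume "x \<in> carrier S" "y \<in> carrier S" "x \<in> J \<or> y \<in> J"
    then show "p1 (dlt (x, y)) \<in> IOm_top S \<iota>S R f J"
      unfolding phi1_def lin_ext_dlt case_prod_conv kd_def br_def[symmetric]
      by (auto intro!: br_IOm_top kv.subspace_neg[OF subspace_IOm_top])
  qed
  show "psi1 w \<in> Z" if "w \<in> IOm_top S \<iota>S R f J" for w
  proof (rule IOm_top_linear[OF fs_linear_psi1 subspace_Z _ that])
    fix x v assume x: "x \<in> J" and v: "v \<in> KS.C"
    have "KS.mu x (rp (cls KS.K v)) \<in> Z"
      by (rule KS.fs_linear_C[OF KS.fs_linear_mu subspace_Z _ KS.rp_cls_C[OF v]])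
        (use x in \<open>simp add: dlt_Z J.I_r_closed\<close>)
    then show "psi1 (br x v) \<in> Z" using v by (simp add: psi1_br_eq)
  qed
qed (use p1_bot psi1_T psi1_p1 p1_psi1 in \<open>simp_all only: cong_mod_def\<close>)

text \<open>\<open>R\<close> acts on the left entry, which for \<open>b\<close> in \<open>J\<close>
  ends up under \<open>d\<close>: \<open>b \<otimes> d(sa)\<close> equals
  \<open>sb \<otimes> da + ab \<otimes> ds\<close>. The last term vanishes because
  \<open>s = f r\<close>, which is why scalars from \<open>R\<close> pass through.\<close>

lemma compat_act_p1: "compat_act (carrier R) (act_hh S f) (act_IOm S f) p1 (hh0_top S J) T"
  unfolding compat_act_def hh0_top_def
proof (intro ballI)
  note trans = cong_mod_trans[OF subspace_T] and sym = cong_mod_sym[OF subspace_T]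
  fix r v assume r: "r \<in> carrier R" and v: "v \<in> Z"
  define s where "s = f r"
  have s: "s \<in> carrier S" using r by (simp add: s_def)
  have act_br: "act_IOm S f r (br x u) = br (s \<otimes> x) u" for x u
    by (simp add: act_IOm_def br_def s_def)
  have lin_IOm: "fs_linear (act_IOm S f r)" by (simp add: act_IOm_def)
  have "cong_mod T (p1 (act_hh S f r v)) (act_IOm S f r (p1 v))"
  proof (rule cong_mod_Z[OF subspace_T _ _ _ v])
    show "fs_linear (\<lambda>v. p1 (act_hh S f r v))"
      unfolding act_hh_def by (rule fs_linear_comp_lin_ext) auto
    show "fs_linear (\<lambda>v. act_IOm S f r (p1 v))"
      by (rule fs_linear_comp[OF fs_linear_p1 lin_IOm p1_fin_supp])
    fix a b assume ab: "a \<in> carrier S" "b \<in> carrier S" "a \<in> J \<or> b \<in> J"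
    have hh: "act_hh S f r (dlt (a, b)) = dlt (s \<otimes> a, b)" by (simp add: act_hh_def s_def)
    show "cong_mod T (p1 (act_hh S f r (dlt (a, b)))) (act_IOm S f r (p1 (dlt (a, b))))"
    proof (cases "a \<in> J")
      case True
      then have "s \<otimes> a \<in> J" using s by (intro J.I_l_closed)
      then show ?thesis using True by (simp only: hh p1_left act_br cong_mod_refl[OF subspace_T])
    next
      case False
      then have b: "b \<in> J" using ab by simp
      have "p1 (dlt (a, b)) = - br b (dlt (\<one>, a))"
        using False b by (simp only: phi1_def br_def kd_def lin_ext_dlt case_prod_conv if_True if_False)
      then have eq: "act_IOm S f r (p1 (dlt (a, b))) = - br (s \<otimes> b) (dlt (\<one>, a))"
        by (simp only: fs_linear_neg[OF lin_IOm] act_br[unfolded br_def] br_def dlt_fin_supp)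
      have "cong_mod T (p1 (dlt (s \<otimes> a, b))) (- br b (dlt (\<one>, s \<otimes> a)))"
        using ab b s by (intro p1_right) auto
      moreover have "cong_mod T (- br b (dlt (\<one>, s \<otimes> a))) (- (br (s \<otimes> b) (dlt (\<one>, a)) + br (a \<otimes> b) (dlt (\<one>, s))))"
        using ab b s by (intro cong_mod_minus[OF subspace_T] br_leibniz)
      moreover have "cong_mod T (- (br (s \<otimes> b) (dlt (\<one>, a)) + br (a \<otimes> b) (dlt (\<one>, s)))) (- (br (s \<otimes> b) (dlt (\<one>, a)) + 0))"
      proof -
        have "br (a \<otimes> b) (dlt (\<one>, s)) \<in> T"
          using ab b r unfolding s_def by (intro br_K KS.K_cong(5) J.I_l_closed) auto
        then show ?thesis
          by (intro cong_mod_minus[OF subspace_T] cong_mod_add[OF subspace_T] cong_mod_refl[OF subspace_T])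
            (simp only: cong_mod_0[OF subspace_T])
      qed
      ultimately show ?thesis unfolding hh eq by (simp only: add_0_right) (blast intro: trans)
    qed
  qed
  then show "(\<lambda>y. p1 (act_hh S f r v) y - act_IOm S f r (p1 v) y) \<in> T"
    by (simp only: cong_mod_def fun_diff_def)
qed

end

section \<open>The second isomorphism\<close>

lemma (in ideal) rp_coset:
  assumes "x \<in> carrier R"
  obtains h where "h \<in> I" "rp (I +> x) = h \<oplus> x"
proof -
  have "x \<in> I +> x" by (rule a_rcos_self[OF assms])
  then have "rp (I +> x) \<in> I +> x" unfolding rp_def by (rule someI[of "\<lambda>v. v \<in> _"])
  then show ?thesis using that by (auto simp: a_r_coset_def')
qed

lemma (in ideal) coset_absorb:
  assumes "h \<in> I" "x \<in> carrier R"
  shows "I +> (h \<oplus> x) = I +> x"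
proof -
  have "h \<oplus> x \<in> I +> x" using assms(1) by (auto simp: a_r_coset_def')
  then show ?thesis using a_repr_independence'[OF _ assms(2)] by metis
qed

lemma (in ideal) coset_rp: "x \<in> carrier R \<Longrightarrow> I +> rp (I +> x) = I +> x"
  by (metis rp_coset coset_absorb)

lemma (in ideal) rp_coset_closed: "x \<in> carrier R \<Longrightarrow> rp (I +> x) \<in> carrier R"
  by (metis rp_coset Icarr a_closed)

lemma (in ideal) Quot_cases:
  assumes "\<beta> \<in> carrier (R Quot I)"
  obtains x where "x \<in> carrier R" "\<beta> = I +> x"
  using assms by (auto simp: FactRing_def A_RCOSETS_def')

context excision_data
begin

abbreviation q :: "'s \<Rightarrow> 's set" where "q x \<equiv> J +> x"

lemma q_hom: "q \<in> ring_hom S (S Quot J)"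
  by (rule J.rcos_ring_hom)

lemma q_closed [simp]: "x \<in> carrier S \<Longrightarrow> q x \<in> carrier (S Quot J)"
  by (rule ring_hom_closed[OF q_hom])

text \<open>The chosen representative differs from \<open>a\<close> by an element of
  \<open>I\<close>, and its image under \<open>f\<close> is absorbed by \<open>J\<close>. So the map
  \<open>R/I \<rightarrow> S/J\<close> is independent of the choice.\<close>

lemma qmap_eq:
  assumes "a \<in> carrier R"
  shows "qmap S f J (I +>\<^bsub>R\<^esub> a) = q (f a)"
proof -
  obtain i where i: "i \<in> I" "rp (I +>\<^bsub>R\<^esub> a) = i \<oplus>\<^bsub>R\<^esub> a"
    by (rule ideal.rp_coset[OF I assms])
  then have "f (i \<oplus>\<^bsub>R\<^esub> a) = f i \<oplus> f a"
    using I_carrier assms by (intro ring_hom_add[OF f]) auto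
  then show ?thesis
    using J.coset_absorb[of "f i" "f a"] i assms by (simp add: qmap_def J_eq)
qed

sublocale KQ: kahler_data "S Quot J" "qiota S \<iota>S J" "R Quot I" "qmap S f J"
proof -
  interpret Q: cring "S Quot J" by (rule J.quotient_is_cring[OF S.is_cring])
  have "qiota S \<iota>S J = q \<circ> \<iota>S" by (simp add: fun_eq_iff qiota_def)
  then have "qiota S \<iota>S J \<in> ring_hom kring (S Quot J)"
    using ring_hom_trans[OF \<iota>S q_hom] by simp
  moreover have "qmap S f J \<alpha> \<in> carrier (S Quot J)" if "\<alpha> \<in> carrier (R Quot I)" for \<alpha>
    using that by (rule ideal.Quot_cases[OF I]) (simp add: qmap_eq)
  ultimately show "kahler_data (S Quot J) (qiota S \<iota>S J) (R Quot I) (qmap S f J)"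
    by unfold_locales
qed

lemma q_add: "x \<in> carrier S \<Longrightarrow> y \<in> carrier S \<Longrightarrow> q x \<oplus>\<^bsub>S Quot J\<^esub> q y = q (x \<oplus> y)"
  and q_mult: "x \<in> carrier S \<Longrightarrow> y \<in> carrier S \<Longrightarrow> q x \<otimes>\<^bsub>S Quot J\<^esub> q y = q (x \<otimes> y)"
  using ring_hom_add[OF q_hom] ring_hom_mult[OF q_hom] by simp_all

section \<open>Differentials of S over R and of S/J over R/I\<close>

definition M :: "('s \<times> 's \<Rightarrow> 'k) \<Rightarrow> ('s set \<times> 's set \<Rightarrow> 'k)" where
  "M = lin_ext (\<lambda>(b, c). dlt (q b, q c))"

text \<open>Lifts both entries of a symbol to \<open>S\<close>. It depends on choices, but on
  classes it is the inverse of \<open>M\<close>.\<close>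

definition L :: "('s set \<times> 's set \<Rightarrow> 'k) \<Rightarrow> ('s \<times> 's \<Rightarrow> 'k)" where
  "L = lin_ext (\<lambda>(\<beta>, \<gamma>). dlt (rp \<beta>, rp \<gamma>))"

lemma fs_linear_M [simp]: "fs_linear M" and fs_linear_L [simp]: "fs_linear L"
  by (simp_all add: M_def L_def)

lemma M_dlt [simp]: "M (dlt (b, c)) = dlt (q b, q c)" and L_dlt [simp]: "L (dlt (\<beta>, \<gamma>)) = dlt (rp \<beta>, rp \<gamma>)"
  by (simp_all add: M_def L_def)

lemma M_fin_supp: "M v \<in> fin_supp" and L_fin_supp: "L w \<in> fin_supp"
  unfolding M_def L_def by (rule lin_ext_fin_supp, simp add: split_beta)+

lemma M_C: "v \<in> KS.C \<Longrightarrow> M v \<in> KQ.C"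
  by (rule KS.fs_linear_C[OF fs_linear_M KQ.subspace_C]) simp_all

lemma M_K:
  assumes "v \<in> KS.K"
  shows "M v \<in> KQ.K"
proof (rule KS.K_map[OF fs_linear_M KQ.subspace_K _ _ _ _ _ assms])
  fix b a assume b: "b \<in> carrier S" and a: "a \<in> carrier R"
  have "I +>\<^bsub>R\<^esub> a \<in> carrier (R Quot I)" using a by (auto simp: FactRing_def A_RCOSETS_def')
  then show "M (dlt (b, f a)) \<in> KQ.K"
    using KQ.K_cong(5)[of "q b" "I +>\<^bsub>R\<^esub> a"] a b by (simp add: qmap_eq)
next
  fix e b c assume b: "b \<in> carrier S" "c \<in> carrier S"
  show "cong_mod KQ.K (M (dlt (\<iota>S e \<otimes> b, c))) (ksc e (M (dlt (b, c))))"
    using KQ.K_cong(2)[of "q b" "q c" e] b by (simp add: qiota_def q_mult)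
next
  fix b b' c assume b: "b \<in> carrier S" "b' \<in> carrier S" "c \<in> carrier S"
  show "cong_mod KQ.K (M (dlt (b \<oplus> b', c))) (M (dlt (b, c)) + M (dlt (b', c)))"
    using KQ.K_cong(1)[of "q b" "q b'" "q c"] b by (simp add: q_add)
  show "cong_mod KQ.K (M (dlt (b, b' \<oplus> c))) (M (dlt (b, b')) + M (dlt (b, c)))"
    using KQ.K_cong(3)[of "q b" "q b'" "q c"] b by (simp add: q_add)
  show "cong_mod KQ.K (M (dlt (b, b' \<otimes> c))) (M (dlt (b \<otimes> b', c)) + M (dlt (b \<otimes> c, b')))"
    using KQ.K_cong(4)[of "q b" "q b'" "q c"] b by (simp add: q_mult)
qed

text \<open>Another lift of the coefficient adds a term \<open>i dc\<close>, another lift of the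
  argument adds \<open>x dj\<close>, with \<open>i\<close> and \<open>j\<close> in \<open>J\<close>.
  Both are zero in \<Omega>, so the choices in \<open>L\<close> are harmless.\<close>

lemma L_q:
  assumes "x \<in> carrier S" "y \<in> carrier S"
  shows "cong_mod KS.K (L (dlt (q x, q y))) (dlt (x, y))"
proof -
  note trans = cong_mod_trans[OF KS.subspace_K] and add = cong_mod_add[OF KS.subspace_K]
    and refl = cong_mod_refl[OF KS.subspace_K] and zero = cong_mod_0[OF KS.subspace_K, THEN iffD2]
  obtain i where i: "i \<in> J" "rp (q x) = i \<oplus> x" by (rule J.rp_coset[OF assms(1)])
  obtain j where j: "j \<in> J" "rp (q y) = j \<oplus> y" by (rule J.rp_coset[OF assms(2)])
  have "cong_mod KS.K (dlt (i \<oplus> x, j \<oplus> y)) (dlt (i, j \<oplus> y) + dlt (x, j \<oplus> y))"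
    using i j assms by (intro KS.K_cong) simp_all
  moreover have "cong_mod KS.K (dlt (i, j \<oplus> y) + dlt (x, j \<oplus> y)) (0 + (dlt (x, j) + dlt (x, y)))"
    using i j assms by (intro add zero J_kills_K KS.K_cong) simp_all
  moreover have "cong_mod KS.K (0 + (dlt (x, j) + dlt (x, y))) (0 + (0 + dlt (x, y)))"
    using i j assms by (intro add refl zero dJ_K)
  ultimately have "cong_mod KS.K (dlt (i \<oplus> x, j \<oplus> y)) (0 + (0 + dlt (x, y)))"
    by (blast intro: trans)
  then show ?thesis by (simp add: i j)
qed

lemma L_C: "w \<in> KQ.C \<Longrightarrow> L w \<in> KS.C"
  by (rule KQ.fs_linear_C[OF fs_linear_L KS.subspace_C])
    (auto elim!: J.Quot_cases simp: J.rp_coset_closed)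

lemma L_K:
  assumes "w \<in> KQ.K"
  shows "L w \<in> KS.K"
proof (rule KQ.K_map[OF fs_linear_L KS.subspace_K _ _ _ _ _ assms])
  note trans = cong_mod_trans[OF KS.subspace_K] and sym = cong_mod_sym[OF KS.subspace_K]
    and add = cong_mod_add[OF KS.subspace_K]
  \<comment> \<open>\<open>rp\<close> respects neither sums nor products of cosets. Each relation is
    therefore moved to fixed lifts in \<open>S\<close> by \<open>L_q\<close>, applied there, and
    moved back.\<close>
  have chain: "cong_mod KS.K (L (dlt (q x, q y))) z'"
    if "x \<in> carrier S" "y \<in> carrier S" "cong_mod KS.K (dlt (x, y)) z" "cong_mod KS.K z' z" for x y z z'
    using L_q[OF that(1,2)] that(3,4) by (blast intro: trans sym)
  fix \<beta> assume "\<beta> \<in> carrier (S Quot J)"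
  then obtain b where b: "b \<in> carrier S" "\<beta> = q b" by (rule J.Quot_cases)
  { fix \<alpha> assume "\<alpha> \<in> carrier (R Quot I)"
    then obtain a where a: "a \<in> carrier R" "\<alpha> = I +>\<^bsub>R\<^esub> a" by (rule ideal.Quot_cases[OF I])
    have "cong_mod KS.K (L (dlt (q b, q (f a)))) (dlt (b, f a))"
      using a b by (intro L_q) simp_all
    then show "L (dlt (\<beta>, qmap S f J \<alpha>)) \<in> KS.K"
      using KS.K_cong(5)[OF b(1) a(1)] cong_mod_mem[OF KS.subspace_K] by (simp only: a b qmap_eq) }
  fix \<gamma> assume "\<gamma> \<in> carrier (S Quot J)"
  then obtain c where c: "c \<in> carrier S" "\<gamma> = q c" by (rule J.Quot_cases)
  { fix e
    have "cong_mod KS.K (L (dlt (q (\<iota>S e \<otimes> b), q c))) (ksc e (L (dlt (q b, q c))))"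
      by (rule chain[OF _ c(1) KS.K_cong(2)[OF b(1) c(1)] cong_mod_scale[OF KS.subspace_K L_q]]) (simp_all add: b c)
    then show "cong_mod KS.K (L (dlt (qiota S \<iota>S J e \<otimes>\<^bsub>S Quot J\<^esub> \<beta>, \<gamma>))) (ksc e (L (dlt (\<beta>, \<gamma>))))"
      by (simp only: b c qiota_def q_mult KS.\<iota>_closed) }
  fix \<delta> assume "\<delta> \<in> carrier (S Quot J)"
  then obtain d where d: "d \<in> carrier S" "\<delta> = q d" by (rule J.Quot_cases)
  have "cong_mod KS.K (L (dlt (q (b \<oplus> c), q d))) (L (dlt (q b, q d)) + L (dlt (q c, q d)))"
    by (rule chain[OF _ d(1) KS.K_cong(1)[OF b(1) c(1) d(1)] add[OF L_q L_q]]) (simp_all add: b c d)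
  then show "cong_mod KS.K (L (dlt (\<beta> \<oplus>\<^bsub>S Quot J\<^esub> \<gamma>, \<delta>))) (L (dlt (\<beta>, \<delta>)) + L (dlt (\<gamma>, \<delta>)))"
    by (simp only: b c d q_add)
  have "cong_mod KS.K (L (dlt (q b, q (c \<oplus> d)))) (L (dlt (q b, q c)) + L (dlt (q b, q d)))"
    by (rule chain[OF b(1) _ KS.K_cong(3)[OF b(1) c(1) d(1)] add[OF L_q L_q]]) (simp_all add: b c d)
  then show "cong_mod KS.K (L (dlt (\<beta>, \<gamma> \<oplus>\<^bsub>S Quot J\<^esub> \<delta>))) (L (dlt (\<beta>, \<gamma>)) + L (dlt (\<beta>, \<delta>)))"
    by (simp only: b c d q_add)
  have "cong_mod KS.K (L (dlt (q b, q (c \<otimes> d)))) (L (dlt (q (b \<otimes> c), q d)) + L (dlt (q (b \<otimes> d), q c)))"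
    by (rule chain[OF b(1) _ KS.K_cong(4)[OF b(1) c(1) d(1)] add[OF L_q L_q]]) (simp_all add: b c d)
  then show "cong_mod KS.K (L (dlt (\<beta>, \<gamma> \<otimes>\<^bsub>S Quot J\<^esub> \<delta>)))
      (L (dlt (\<beta> \<otimes>\<^bsub>S Quot J\<^esub> \<gamma>, \<delta>)) + L (dlt (\<beta> \<otimes>\<^bsub>S Quot J\<^esub> \<delta>, \<gamma>)))"
    by (simp only: b c d q_mult)
qed

lemma L_M_cong: "v \<in> KS.C \<Longrightarrow> cong_mod KS.K (L (M v)) v"
  by (rule KS.cong_mod_C[OF KS.subspace_K fs_linear_comp[OF fs_linear_M fs_linear_L M_fin_supp] fs_linear_id])
    (simp_all only: M_dlt L_q)

lemma M_L_cong: "w \<in> KQ.C \<Longrightarrow> cong_mod KQ.K (M (L w)) w"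
  by (rule KQ.cong_mod_C[OF KQ.subspace_K fs_linear_comp[OF fs_linear_L fs_linear_M L_fin_supp] fs_linear_id])
    (auto elim!: J.Quot_cases simp: J.coset_rp cong_mod_refl)

lemma M_cong: "cong_mod KS.K u v \<Longrightarrow> u \<in> KS.C \<Longrightarrow> v \<in> KS.C \<Longrightarrow> cong_mod KQ.K (M u) (M v)"
  unfolding cong_mod_def using KS.C_fin_supp
  by (subst fs_linear_diff[OF fs_linear_M, symmetric]) (auto intro: M_K)

lemma L_cong: "cong_mod KQ.K u v \<Longrightarrow> u \<in> KQ.C \<Longrightarrow> v \<in> KQ.C \<Longrightarrow> cong_mod KS.K (L u) (L v)"
  unfolding cong_mod_def using KQ.C_fin_supp
  by (subst fs_linear_diff[OF fs_linear_L, symmetric]) (auto intro: L_K)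

lemma om_map_cls: "v \<in> KS.C \<Longrightarrow> om_map S \<iota>S R f I J (cls KS.K v) = cls KQ.K (M v)"
  unfolding om_map_def M_def[symmetric] cls_eq[OF KQ.subspace_K]
  by (intro M_cong rp_cls_cong KS.rp_cls_C KS.subspace_K)

section \<open>Comparison of the two tensor products\<close>

abbreviation q2 :: "'s \<Rightarrow> 's set" where "q2 x \<equiv> J2 +> x"
abbreviation "\<Omega>Q \<equiv> Omq S \<iota>S R f I J"
abbreviation "TQ \<equiv> QT_rel S \<iota>S R f I J"
abbreviation p2 :: "('s \<times> ('s \<times> 's \<Rightarrow> 'k) set \<Rightarrow> 'k) \<Rightarrow> ('s set \<times> ('s set \<times> 's set \<Rightarrow> 'k) set \<Rightarrow> 'k)" where
  "p2 \<equiv> phi2 S \<iota>S R f I J"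

definition brQ :: "'s set \<Rightarrow> ('s set \<times> 's set \<Rightarrow> 'k) \<Rightarrow> ('s set \<times> ('s set \<times> 's set \<Rightarrow> 'k) set \<Rightarrow> 'k)" where
  "brQ \<xi> w = dlt (\<xi>, cls KQ.K w)"

sublocale J2: ideal J2 S
  by (rule S.ideal_prod_is_ideal[OF ideal_J ideal_J])

lemma J2_J: "x \<in> J2 \<Longrightarrow> x \<in> J"
  using S.ideal_prod_inter[OF ideal_J ideal_J] by auto

lemma subspace_TQ [simp]: "kv.subspace TQ"
  by (simp add: QT_rel_def)

lemmas TQ_cong = tens_rel_cong[OF QT_rel_def[of S \<iota>S R f I J]]

lemma q2_II2: "x \<in> J \<Longrightarrow> q2 x \<in> II2 S J"
  by (auto simp: II2_def)

lemma II2_cases: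
  assumes "\<xi> \<in> II2 S J" obtains x where "x \<in> J" "\<xi> = q2 x"
  using assms by (auto simp: II2_def)

lemma brQ_cong: "cong_mod KQ.K u v \<Longrightarrow> brQ \<xi> u = brQ \<xi> v"
  unfolding brQ_def by (metis cls_eq[OF KQ.subspace_K])

lemma q2_mult_rp:
  assumes "s \<in> carrier S" "x \<in> J"
  shows "q2 (s \<otimes> rp (q2 x)) = q2 (s \<otimes> x)"
proof -
  obtain h where h: "h \<in> J2" "rp (q2 x) = h \<oplus> x"
    by (rule J2.rp_coset[OF J_carrier[OF assms(2)]])
  have "s \<otimes> (h \<oplus> x) = s \<otimes> h \<oplus> s \<otimes> x"
    using assms h by (simp add: S.r_distr J2.Icarr)
  then show ?thesis
    using J2.coset_absorb[OF J2.I_l_closed[OF h(1) assms(1)], of "s \<otimes> x"] assms h by simp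
qed

text \<open>Replacing \<open>s\<close> by \<open>j \<oplus> s\<close> changes the product by
  \<open>jx\<close>, which lies in \<open>J2\<close>: this is why \<open>S/J\<close> acts on
  \<open>J/J2\<close>.\<close>

lemma II2_act_eq:
  assumes "s \<in> carrier S" "x \<in> J"
  shows "II2_act S J (q s) (q2 x) = q2 (s \<otimes> x)"
proof -
  obtain j where j: "j \<in> J" "rp (q s) = j \<oplus> s" by (rule J.rp_coset[OF assms(1)])
  have "q2 ((j \<oplus> s) \<otimes> rp (q2 x)) = q2 ((j \<oplus> s) \<otimes> x)"
    using j assms by (intro q2_mult_rp) auto
  moreover have "(j \<oplus> s) \<otimes> x = j \<otimes> x \<oplus> s \<otimes> x"
    using j assms by (simp add: S.l_distr)
  moreover have "q2 (j \<otimes> x \<oplus> s \<otimes> x) = q2 (s \<otimes> x)"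
    using assms j by (intro J2.coset_absorb ideal_prod.prod) auto
  ultimately show ?thesis by (simp add: II2_act_def j)
qed

lemma p2_br: "v \<in> KS.C \<Longrightarrow> p2 (br x v) = brQ (q2 x) (M v)"
  by (simp add: phi2_def br_def brQ_def om_map_cls)

lemma fs_linear_p2 [simp]: "fs_linear p2"
  by (simp add: phi2_def)

lemma M_mu:
  assumes "s \<in> carrier S" "v \<in> KS.C"
  shows "cong_mod KQ.K (M (KS.mu s v)) (KQ.mu (q s) (M v))"
proof (rule KS.cong_mod_C[OF KQ.subspace_K _ fs_linear_comp[OF fs_linear_M KQ.fs_linear_mu M_fin_supp] _ assms(2)])
  show "fs_linear (\<lambda>v. M (KS.mu s v))"
    unfolding KS.mu_def by (rule fs_linear_comp_lin_ext) auto
qed (simp add: assms(1) q_mult cong_mod_refl)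

text \<open>Each relation over \<open>S\<close> goes to the relation of the same kind over
  \<open>S/J\<close>, since passing to cosets commutes with sums, products and the actions.\<close>

lemma p2_T:
  assumes "w \<in> T"
  shows "p2 w \<in> TQ"
proof (rule tens_rel_map[OF fs_linear_p2 subspace_TQ _ _ _ _ assms[unfolded IOm_rel_def]])
  fix x n assume x: "x \<in> J" and n: "n \<in> \<Omega>"
  from n obtain v where v: "v \<in> KS.C" "n = cls KS.K v" by (rule KS.kahler_cases)
  have Mv: "cls KQ.K (M v) \<in> \<Omega>Q" using v by (intro KQ.cls_in_kahler M_C)
  note p2 = p2_br[unfolded br_def brQ_def]
  { fix y assume y: "y \<in> J"
    have "cong_mod TQ (dlt (q2 x <+> q2 y, cls KQ.K (M v))) (dlt (q2 x, cls KQ.K (M v)) + dlt (q2 y, cls KQ.K (M v)))"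
      using x y Mv by (intro TQ_cong q2_II2)
    then show "cong_mod TQ (p2 (dlt (x \<oplus> y, n))) (p2 (dlt (x, n)) + p2 (dlt (y, n)))"
      using x y v by (simp only: p2 J2.a_rcos_sum J_carrier) }
  { fix n' assume "n' \<in> \<Omega>"
    then obtain v' where v': "v' \<in> KS.C" "n' = cls KS.K v'" by (rule KS.kahler_cases)
    have "M (v + v') = M v + M v'"
      using v v' KS.C_fin_supp by (intro fs_linear_add[OF fs_linear_M]) auto
    moreover have "cong_mod TQ (dlt (q2 x, kahler_add (S Quot J) (qiota S \<iota>S J) (R Quot I) (qmap S f J) (cls KQ.K (M v)) (cls KQ.K (M v'))))
       (dlt (q2 x, cls KQ.K (M v)) + dlt (q2 x, cls KQ.K (M v')))"
      using x v v' by (intro TQ_cong q2_II2 KQ.cls_in_kahler M_C)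
    ultimately show "cong_mod TQ (p2 (dlt (x, kahler_add S \<iota>S R f n n'))) (p2 (dlt (x, n)) + p2 (dlt (x, n')))"
      using v v' by (simp only: p2 KS.kahler_add_cls KQ.kahler_add_cls kv.subspace_add[OF KS.subspace_C]) }
  { fix s assume s: "s \<in> carrier S"
    have "cong_mod TQ (dlt (II2_act S J (q s) (q2 x), cls KQ.K (M v)))
       (dlt (q2 x, kahler_act (S Quot J) (qiota S \<iota>S J) (R Quot I) (qmap S f J) (q s) (cls KQ.K (M v))))"
      using x s Mv by (intro TQ_cong q2_II2 q_closed)
    moreover have "cls KQ.K (M (KS.mu s v)) = cls KQ.K (KQ.mu (q s) (M v))"
      using s v M_mu by (simp only: cls_eq[OF KQ.subspace_K])
    ultimately show "cong_mod TQ (p2 (dlt (s \<otimes> x, n))) (p2 (dlt (x, kahler_act S \<iota>S R f s n)))"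
      using x s v by (simp only: p2 II2_act_eq KS.kahler_act_cls KQ.kahler_act_cls KS.mu_C M_C q_closed) }
  fix e
  have "cong_mod TQ (dlt (II2_act S J (qiota S \<iota>S J e) (q2 x), cls KQ.K (M v))) (ksc e (dlt (q2 x, cls KQ.K (M v))))"
    using x Mv by (intro TQ_cong q2_II2)
  then show "cong_mod TQ (p2 (dlt (\<iota>S e \<otimes> x, n))) (ksc e (p2 (dlt (x, n))))"
    using x v by (simp only: p2 II2_act_eq qiota_def KS.\<iota>_closed)
qed

text \<open>The inverse of \<open>p2\<close>: both factors are lifted to chosen representatives, the
  left one from \<open>J/J2\<close> to \<open>J\<close>.\<close>

definition chi :: "('s set \<times> ('s set \<times> 's set \<Rightarrow> 'k) set \<Rightarrow> 'k) \<Rightarrow> ('s \<times> ('s \<times> 's \<Rightarrow> 'k) set \<Rightarrow> 'k)" where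
  "chi = lin_ext (\<lambda>(\<xi>, \<eta>). br (rp \<xi>) (L (rp \<eta>)))"

lemma fs_linear_chi [simp]: "fs_linear chi"
  by (simp add: chi_def)

lemma chi_brQ_eq: "w \<in> KQ.C \<Longrightarrow> chi (brQ \<xi> w) = br (rp \<xi>) (L w)"
  unfolding chi_def brQ_def lin_ext_dlt case_prod_conv
  by (intro br_cong L_cong rp_cls_cong KQ.rp_cls_C KQ.subspace_K)

lemma rp_q2_J: "x \<in> J \<Longrightarrow> rp (q2 x) \<in> J"
  by (metis J2.rp_coset J2_J J.a_closed J_carrier)

text \<open>The chosen lift of \<open>q2 x\<close> is \<open>h \<oplus> x\<close> with
  \<open>h\<close> in \<open>J2\<close>, and tensors with left factor in \<open>J2\<close> vanish by
  \<open>br_J2\<close>.\<close>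

lemma chi_brQ:
  assumes "x \<in> J" "w \<in> KQ.C"
  shows "cong_mod T (chi (brQ (q2 x) w)) (br x (L w))"
proof -
  obtain h where h: "h \<in> J2" "rp (q2 x) = h \<oplus> x" by (rule J2.rp_coset[OF J_carrier[OF assms(1)]])
  have "cong_mod T (br (h \<oplus> x) (L w)) (br h (L w) + br x (L w))"
    using assms J2_J[OF h(1)] by (intro br_add_left L_C)
  moreover have "cong_mod T (br h (L w) + br x (L w)) (0 + br x (L w))"
    using assms h by (intro cong_mod_add[OF subspace_T] cong_mod_refl[OF subspace_T])
      (simp only: cong_mod_0[OF subspace_T] br_J2 L_C)
  ultimately show ?thesis
    using assms by (simp only: chi_brQ_eq h add_0_left) (rule cong_mod_trans[OF subspace_T])
qed

text \<open>Only a congruence, because the coset of \<open>s \<otimes> b\<close> has a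
  representative of its own, unrelated to that of \<open>q b\<close>.\<close>

lemma L_mu:
  assumes "s \<in> carrier S" "w \<in> KQ.C"
  shows "cong_mod KS.K (KS.mu s (L w)) (L (KQ.mu (q s) w))"
proof (rule KQ.cong_mod_C[OF KS.subspace_K fs_linear_comp[OF fs_linear_L KS.fs_linear_mu L_fin_supp] _ _ assms(2)])
  show "fs_linear (\<lambda>w. L (KQ.mu (q s) w))"
    unfolding KQ.mu_def by (rule fs_linear_comp_lin_ext) auto
  fix \<beta> \<gamma> assume "\<beta> \<in> carrier (S Quot J)" "\<gamma> \<in> carrier (S Quot J)"
  then obtain b c where b: "b \<in> carrier S" "\<beta> = q b" and c: "c \<in> carrier S" "\<gamma> = q c"
    by (elim J.Quot_cases)
  have "cong_mod KS.K (KS.mu s (L (dlt (q b, q c)))) (KS.mu s (dlt (b, c)))"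
    using assms b c by (intro KS.mu_cong L_q L_C) simp_all
  moreover have "cong_mod KS.K (dlt (s \<otimes> b, c)) (L (dlt (q (s \<otimes> b), q c)))"
    using assms b c by (intro cong_mod_sym[OF KS.subspace_K L_q]) simp_all
  ultimately show "cong_mod KS.K (KS.mu s (L (dlt (\<beta>, \<gamma>)))) (L (KQ.mu (q s) (dlt (\<beta>, \<gamma>))))"
    using assms b c by (simp only: KS.mu_dlt KQ.mu_dlt q_mult) (rule cong_mod_trans[OF KS.subspace_K])
qed

lemma chi_TQ:
  assumes "w \<in> TQ"
  shows "chi w \<in> T"
proof (rule tens_rel_map[OF fs_linear_chi subspace_T _ _ _ _ assms[unfolded QT_rel_def]])
  note trans = cong_mod_trans[OF subspace_T] and sym = cong_mod_sym[OF subspace_T]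
    and add = cong_mod_add[OF subspace_T]
  fix \<xi> n assume \<xi>: "\<xi> \<in> II2 S J" and n: "n \<in> \<Omega>Q"
  from \<xi> obtain x where x: "x \<in> J" "\<xi> = q2 x" by (rule II2_cases)
  from n obtain w where w: "w \<in> KQ.C" "n = cls KQ.K w" by (rule KQ.kahler_cases)
  { fix \<xi>' assume "\<xi>' \<in> II2 S J"
    then obtain y where y: "y \<in> J" "\<xi>' = q2 y" by (rule II2_cases)
    have "cong_mod T (chi (brQ (q2 (x \<oplus> y)) w)) (br (x \<oplus> y) (L w))"
      using x y w by (intro chi_brQ J.a_closed)
    moreover have "cong_mod T (br (x \<oplus> y) (L w)) (br x (L w) + br y (L w))"
      using x y w by (intro br_add_left L_C)
    moreover have "cong_mod T (br x (L w) + br y (L w)) (chi (brQ (q2 x) w) + chi (brQ (q2 y) w))"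
      using x y w by (intro add sym[OF chi_brQ])
    ultimately have "cong_mod T (chi (brQ (q2 (x \<oplus> y)) w)) (chi (brQ (q2 x) w) + chi (brQ (q2 y) w))"
      by (blast intro: trans)
    then show "cong_mod T (chi (dlt (\<xi> <+> \<xi>', n))) (chi (dlt (\<xi>, n)) + chi (dlt (\<xi>', n)))"
      using x(1) y(1) by (simp only: x(2) y(2) w(2) brQ_def J2.a_rcos_sum J_carrier) }
  { fix n' assume "n' \<in> \<Omega>Q"
    then obtain w' where w': "w' \<in> KQ.C" "n' = cls KQ.K w'" by (rule KQ.kahler_cases)
    have "cong_mod T (chi (brQ (q2 x) (w + w'))) (br x (L (w + w')))"
      using x w w' by (intro chi_brQ kv.subspace_add[OF KQ.subspace_C])
    moreover have "L (w + w') = L w + L w'"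
      using w w' KQ.C_fin_supp by (intro fs_linear_add[OF fs_linear_L]) auto
    moreover have "cong_mod T (br x (L w + L w')) (br x (L w) + br x (L w'))"
      using x w w' by (intro br_add_right L_C)
    moreover have "cong_mod T (br x (L w) + br x (L w')) (chi (brQ (q2 x) w) + chi (brQ (q2 x) w'))"
      using x w w' by (intro add sym[OF chi_brQ])
    ultimately have "cong_mod T (chi (brQ (q2 x) (w + w'))) (chi (brQ (q2 x) w) + chi (brQ (q2 x) w'))"
      by (simp only:) (blast intro: trans)
    then show "cong_mod T (chi (dlt (\<xi>, kahler_add (S Quot J) (qiota S \<iota>S J) (R Quot I) (qmap S f J) n n')))
        (chi (dlt (\<xi>, n)) + chi (dlt (\<xi>, n')))"
      by (simp only: x(2) w(2) w'(2) brQ_def KQ.kahler_add_cls) }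
  { fix \<beta> assume "\<beta> \<in> carrier (S Quot J)"
    then obtain s where s: "s \<in> carrier S" "\<beta> = q s" by (rule J.Quot_cases)
    have "cong_mod T (chi (brQ (q2 (s \<otimes> x)) w)) (br (s \<otimes> x) (L w))"
      using x s w by (intro chi_brQ J.I_l_closed)
    moreover have "cong_mod T (br (s \<otimes> x) (L w)) (br x (KS.mu s (L w)))"
      using x s w by (intro br_mult L_C)
    moreover have "br x (KS.mu s (L w)) = br x (L (KQ.mu (q s) w))"
      using s w by (intro br_cong L_mu)
    moreover have "cong_mod T (br x (L (KQ.mu (q s) w))) (chi (brQ (q2 x) (KQ.mu (q s) w)))"
      using x s w by (intro sym[OF chi_brQ] KQ.mu_C q_closed)
    ultimately have "cong_mod T (chi (brQ (q2 (s \<otimes> x)) w)) (chi (brQ (q2 x) (KQ.mu (q s) w)))"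
      by (simp only:) (blast intro: trans)
    then show "cong_mod T (chi (dlt (II2_act S J \<beta> \<xi>, n)))
        (chi (dlt (\<xi>, kahler_act (S Quot J) (qiota S \<iota>S J) (R Quot I) (qmap S f J) \<beta> n)))"
      using x(1) s(1) w(1) by (simp only: x(2) s(2) w(2) brQ_def II2_act_eq KQ.kahler_act_cls q_closed) }
  fix e
  have "cong_mod T (chi (brQ (q2 (\<iota>S e \<otimes> x)) w)) (br (\<iota>S e \<otimes> x) (L w))"
    using x w by (intro chi_brQ J.I_l_closed KS.\<iota>_closed)
  moreover have "cong_mod T (br (\<iota>S e \<otimes> x) (L w)) (ksc e (br x (L w)))"
    using x w by (intro br_\<iota> L_C)
  moreover have "cong_mod T (ksc e (br x (L w))) (ksc e (chi (brQ (q2 x) w)))"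
    using x w by (intro cong_mod_scale[OF subspace_T] sym[OF chi_brQ])
  ultimately have "cong_mod T (chi (brQ (q2 (\<iota>S e \<otimes> x)) w)) (ksc e (chi (brQ (q2 x) w)))"
    by (blast intro: trans)
  then show "cong_mod T (chi (dlt (II2_act S J (qiota S \<iota>S J e) \<xi>, n))) (ksc e (chi (dlt (\<xi>, n))))"
    using x(1) by (simp only: x(2) w(2) brQ_def II2_act_eq qiota_def KS.\<iota>_closed)
qed

lemma QT_top_linear:
  assumes "fs_linear \<phi>" "kv.subspace N" "\<And>x w. x \<in> J \<Longrightarrow> w \<in> KQ.C \<Longrightarrow> \<phi> (brQ (q2 x) w) \<in> N"
    "w \<in> QT_top S \<iota>S R f I J"
  shows "\<phi> w \<in> N"
  by (rule fs_linear_kspan[OF assms(1,2) _ _ assms(4)[unfolded QT_top_def tens_top_def]])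
    (use assms(3) in \<open>auto simp: brQ_def elim!: KQ.kahler_cases II2_cases\<close>)

lemma brQ_QT_top: "x \<in> J \<Longrightarrow> w \<in> KQ.C \<Longrightarrow> brQ (q2 x) w \<in> QT_top S \<iota>S R f I J"
  unfolding QT_top_def tens_top_def brQ_def
  by (rule kspan_base) (blast intro: KQ.cls_in_kahler q2_II2)

lemma subspace_QT_top [simp]: "kv.subspace (QT_top S \<iota>S R f I J)"
  by (simp add: QT_top_def tens_top_def)

lemma QT_top_fin_supp: "QT_top S \<iota>S R f I J \<subseteq> fin_supp"
  unfolding QT_top_def tens_top_def by (rule kspan_subset) auto

lemma p2_fin_supp: "p2 v \<in> fin_supp"
  unfolding phi2_def by (rule lin_ext_fin_supp) (simp add: split_beta)

lemma chi_fin_supp: "chi w \<in> fin_supp"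
  unfolding chi_def by (rule lin_ext_fin_supp) (simp add: split_beta br_def)

text \<open>On pure tensors \<open>p2\<close> after \<open>chi\<close> is exactly the identity,
  since cosets and classes forget which representative was chosen. The other round trip may change
  the left factor by an element of \<open>J2\<close> and holds only modulo \<open>T\<close>.\<close>

lemma induces_iso_p2: "induces_iso p2 (IOm_top S \<iota>S R f J) T (QT_top S \<iota>S R f I J) TQ"
proof (rule induces_iso_by_inverse[where \<psi> = chi, OF fs_linear_p2 subspace_T subspace_TQ IOm_top_fin_supp QT_top_fin_supp])
  show "p2 v \<in> QT_top S \<iota>S R f I J" if "v \<in> IOm_top S \<iota>S R f J" for v
    by (rule IOm_top_linear[OF fs_linear_p2 subspace_QT_top _ that]) (simp only: p2_br brQ_QT_top M_C)
  show "chi w \<in> IOm_top S \<iota>S R f J" if "w \<in> QT_top S \<iota>S R f I J" for w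
    by (rule QT_top_linear[OF fs_linear_chi subspace_IOm_top _ that])
      (simp only: chi_brQ_eq br_IOm_top rp_q2_J L_C)
  show "chi (p2 v) - v \<in> T" if "v \<in> IOm_top S \<iota>S R f J" for v
  proof (rule IOm_top_linear[OF _ subspace_T _ that])
    show "fs_linear (\<lambda>v. chi (p2 v) - v)"
      by (intro fs_linear_minus fs_linear_id fs_linear_comp[OF fs_linear_p2 fs_linear_chi] p2_fin_supp)
    fix x v assume x: "x \<in> J" and v: "v \<in> KS.C"
    have "cong_mod T (chi (brQ (q2 x) (M v))) (br x (L (M v)))"
      using x v by (intro chi_brQ M_C)
    moreover have "br x (L (M v)) = br x v"
      using v by (intro br_cong L_M_cong)
    ultimately show "chi (p2 (br x v)) - br x v \<in> T"
      using v by (simp only: p2_br cong_mod_def)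
  qed
  show "p2 (chi w) - w \<in> TQ" if "w \<in> QT_top S \<iota>S R f I J" for w
  proof (rule QT_top_linear[OF _ subspace_TQ _ that])
    show "fs_linear (\<lambda>w. p2 (chi w) - w)"
      by (intro fs_linear_minus fs_linear_id fs_linear_comp[OF fs_linear_chi fs_linear_p2] chi_fin_supp)
    fix x w assume x: "x \<in> J" and w: "w \<in> KQ.C"
    have "p2 (chi (brQ (q2 x) w)) = brQ (q2 (rp (q2 x))) (M (L w))"
      using w by (simp only: chi_brQ_eq p2_br L_C)
    also have "\<dots> = brQ (q2 x) w"
      using x w by (simp only: J2.coset_rp J_carrier brQ_cong[OF M_L_cong])
    finally show "p2 (chi (brQ (q2 x) w)) - brQ (q2 x) w \<in> TQ"
      using cong_mod_refl[OF subspace_TQ] by (simp only: cong_mod_def)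
  qed
qed (use p2_T chi_TQ in blast)+

lemma compat_act_p2:
  "compat_act (carrier R) (act_IOm S f) (act_QT S f J) p2 (IOm_top S \<iota>S R f J) TQ"
  unfolding compat_act_def
proof (intro ballI)
  fix r and v :: "'s \<times> ('s \<times> 's \<Rightarrow> 'k) set \<Rightarrow> 'k"
  assume r: "r \<in> carrier R" and v: "v \<in> IOm_top S \<iota>S R f J"
  have IOm: "fs_linear (act_IOm S f r)"
    "\<And>v :: 's \<times> ('s \<times> 's \<Rightarrow> 'k) set \<Rightarrow> 'k. act_IOm S f r v \<in> fin_supp"
    unfolding act_IOm_def by (rule fs_linear_lin_ext, rule lin_ext_fin_supp, simp add: split_beta)
  have QT: "fs_linear (act_QT S f J r)" by (simp add: act_QT_def)
  have "p2 (act_IOm S f r v) - act_QT S f J r (p2 v) \<in> TQ"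
  proof (rule IOm_top_linear[OF _ subspace_TQ _ v])
    show "fs_linear (\<lambda>v. p2 (act_IOm S f r v) - act_QT S f J r (p2 v))"
      by (intro fs_linear_minus fs_linear_comp[OF IOm(1) fs_linear_p2 IOm(2)]
          fs_linear_comp[OF fs_linear_p2 QT p2_fin_supp])
    fix x v assume x: "x \<in> J" and v: "v \<in> KS.C"
    have "act_IOm S f r (br x v) = br (f r \<otimes> x) v" by (simp add: act_IOm_def br_def)
    moreover have "act_QT S f J r (brQ (q2 x) (M v)) = brQ (q2 (f r \<otimes> x)) (M v)"
      using q2_mult_rp[OF f_closed[OF r] x] by (simp add: act_QT_def brQ_def)
    ultimately have "p2 (act_IOm S f r (br x v)) = act_QT S f J r (p2 (br x v))"
      using v by (simp only: p2_br)
    then show "p2 (act_IOm S f r (br x v)) - act_QT S f J r (p2 (br x v)) \<in> TQ"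
      using cong_mod_refl[OF subspace_TQ] by (simp only: cong_mod_def)
  qed
  then show "(\<lambda>y. p2 (act_IOm S f r v) y - act_QT S f J r (p2 v) y) \<in> TQ"
    by (simp only: fun_diff_def)
qed

end

theorem theorem3p6:
  fixes R :: "'r ring" and S :: "'s ring"
    and \<iota>R :: "'k::field \<Rightarrow> 'r" and \<iota>S :: "'k \<Rightarrow> 's"
    and f :: "'r \<Rightarrow> 's" and I :: "'r set"
  assumes "cring R" and "cring S"
    and "\<iota>R \<in> ring_hom kring R" and "\<iota>S \<in> ring_hom kring S"
    and "f \<in> ring_hom R S" and "\<forall>c. f (\<iota>R c) = \<iota>S c"
    and "ideal I R" and "inj_on f I" and "ideal (f ` I) S"
  shows
    "induces_iso (phi1 S \<iota>S R f (f ` I))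
        (hh0_top S (f ` I)) (hh0_bot R \<iota>R S \<iota>S f I (f ` I))
        (IOm_top S \<iota>S R f (f ` I)) (IOm_rel S \<iota>S R f (f ` I))
   \<and> compat_act (carrier R) (act_hh S f) (act_IOm S f) (phi1 S \<iota>S R f (f ` I))
        (hh0_top S (f ` I)) (IOm_rel S \<iota>S R f (f ` I))
   \<and> induces_iso (phi2 S \<iota>S R f I (f ` I))
        (IOm_top S \<iota>S R f (f ` I)) (IOm_rel S \<iota>S R f (f ` I))
        (QT_top S \<iota>S R f I (f ` I)) (QT_rel S \<iota>S R f I (f ` I))
   \<and> compat_act (carrier R) (act_IOm S f) (act_QT S f (f ` I)) (phi2 S \<iota>S R f I (f ` I))
        (IOm_top S \<iota>S R f (f ` I)) (QT_rel S \<iota>S R f I (f ` I))"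
proof -
  interpret excision_data S R \<iota>R \<iota>S f I "f ` I"
    by (rule excision_data.intro[OF assms(2) excision_data_axioms.intro])
      (rule refl assms(1,3-5,7,9) assms(6)[rule_format])+
  show ?thesis
    using induces_iso_p1 compat_act_p1 induces_iso_p2 compat_act_p2 by (intro conjI)
qed

end
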